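(* Let $\Omega\subset\mathbb R^N$ be Lebesgue measurable and $a\in\mathbb R$. (i) Suppose $0<q\le\infty$. If either $0<p,r<\infty$, or $r=\infty$ and $0<p\le\infty$, then $HL^{p,r}_{a,q}$ is a quasi-Banach ideal space with the Fatou property. (ii) Assume $1\le q\le\infty$. If either $1\le r\le p<\infty$, or $p=r=\infty$, then $HL^{p,r}_{a,q}$ is a Banach ideal space with the Fatou property. (iii) If $0<q\le\infty$, $0<r\le\infty$ and $0<p<\infty$, then $HL^{(p,r)}_{a,q}$ is a quasi-Banach ideal space with the Fatou property. (iv) Suppose $1\le q\le\infty$. If either $1\le r\le\infty$ and $1<p<\infty$, or $p=r=\infty$, then $HL^{(p,r)}_{a,q}$ is a Banach ideal space with the Fatou property.
   Context: $\mu$ is Lebesgue measure. For measurable $f$ let $f^*(t)=\inf\{\lambda>0:\mu(\{|f|>\lambda\})\le t\}$ and $f^{**}(t)=\frac1t\int_0^tf^*(s)\,ds$. Put $\|f\|_{p,r}=\left(\int_0^\infty(t^{1/p}f^*(t))^r\frac{dt}t\right)^{1/r}$ for $0<p,r<\infty$ and $\|f\|_{p,\infty}=\sup_{t>0}t^{1/p}f^*(t)$ for $0<p\le\infty$; $\|f\|_{(p,r)}$ is defined by the same formulas with $f^{**}$ in place of $f^*$. $L^{p,r}(A)$, $L^{(p,r)}(A)$ are the spaces of measurable functions on $A$ with finite $\|\cdot\|_{p,r}$, resp. $\|\cdot\|_{(p,r)}$. It is always assumed that $r=\infty$ if $p=\infty$. Let $I=\{-1,0,1,2,\dots\}$, $\Omega_{-1}=\{\omega\in\Omega:|\omega|<1/2\}$,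 $\Omega_k=\{\omega\in\Omega:2^{k-1}\le|\omega|<2^k\}$ for $k\ge0$. The Lorentz-Herz space $HL^{p,r}_{a,q}$ consists of the measurable $f$ on $\Omega$ with $f\chi_{\Omega_k}\in L^{p,r}(\Omega_k)$ for all $k\in I$ and $\|f\|_{HL^{p,r}_{a,q}}=\left(\sum_{k\in I}2^{kaq}\|f\chi_{\Omega_k}\|_{p,r}^q\right)^{1/q}<\infty$ (supremum $\sup_k2^{ka}\|f\chi_{\Omega_k}\|_{p,r}$ if $q=\infty$); $HL^{(p,r)}_{a,q}$ is defined in the same way with $\|\cdot\|_{(p,r)}$. The local spaces $L^{p,r}(\Omega_k)$, $L^{(p,r)}(\Omega_k)$ are assumed to be non-trivial quasi-normed ideal spaces. A quasi-normed ideal space over $\Omega$ is a linear subspace $F\subset L^0(\Omega)$ with a quasi-norm such that (i) $f\in L^0$, $g\in F$, $|f|\le|g|$ a.e. imply $f\in F$, $\|f\|_F\le\|g\|_F$; (ii) $F$ contains a function strictly positive on all of $\Omega$. It is a quasi-Banach (Banach) ideal space if complete (complete and normed by $\|\cdot\|_F$). Fatou property: if $f\in L^0$, $0\le f_n\in F$, $f_n\uparrow|f|$ a.e., $\sup_n\|f_n\|_F<\infty$, then $f\in F$ and $\lim_n\|f_n\|_F=\|f\|_F$. *)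

theory Defs
  imports "HOL-Analysis.Analysis"
begin

section \<open>Rearrangements and Lorentz functionals\<close>

text \<open>
  All exponents \<open>p\<close>, \<open>r\<close>, \<open>q\<close> range over \<^typ>\<open>ennreal\<close>, and extended norms take values in
  \<^typ>\<open>ennreal\<close>, so that they are defined (possibly infinite) for every function.
\<close>

definition enn_powr :: "ennreal \<Rightarrow> real \<Rightarrow> ennreal" where
  "enn_powr x s = (if x = \<infinity> then \<infinity> else ennreal (enn2real x powr s))"
  \<comment> \<open>only used with \<open>s > 0\<close>\<close>

definition rearr :: "'a measure \<Rightarrow> ('a \<Rightarrow> real) \<Rightarrow> real \<Rightarrow> ennreal" where
  "rearr M f t =
     (INF l\<in>{l::real. 0 < l \<and> emeasure M {x \<in> space M. l < \<bar>f x\<bar>} \<le> ennreal t}. ennreal l)"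

definition rearr_avg :: "'a measure \<Rightarrow> ('a \<Rightarrow> real) \<Rightarrow> real \<Rightarrow> ennreal" where
  "rearr_avg M f t = (\<integral>\<^sup>+s\<in>{0<..<t}. rearr M f s \<partial>lborel) / ennreal t"

text \<open>
  The functional applied to \<open>h = f\<^sup>*\<close> or \<open>h = f\<^sup>*\<^sup>*\<close>. The exponent \<open>1 / p\<close> is \<open>0\<close> for \<open>p = \<infinity>\<close>.
  The case \<open>p = \<infinity>\<close>, \<open>r < \<infinity>\<close> is never used.
\<close>

definition lorentz_functional :: "ennreal \<Rightarrow> ennreal \<Rightarrow> (real \<Rightarrow> ennreal) \<Rightarrow> ennreal" where
  "lorentz_functional p r h =
     (if r = \<infinity> then (SUP t\<in>{0<..}. ennreal (t powr enn2real (1 / p)) * h t)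
      else enn_powr
             (\<integral>\<^sup>+t\<in>{0<..}. enn_powr (ennreal (t powr enn2real (1 / p)) * h t) (enn2real r)
                * ennreal (1 / t) \<partial>lborel)
             (1 / enn2real r))"

definition lorentz_norm :: "ennreal \<Rightarrow> ennreal \<Rightarrow> 'a measure \<Rightarrow> ('a \<Rightarrow> real) \<Rightarrow> ennreal" where
  "lorentz_norm p r M f = lorentz_functional p r (rearr M f)"

definition lorentz_avg_norm :: "ennreal \<Rightarrow> ennreal \<Rightarrow> 'a measure \<Rightarrow> ('a \<Rightarrow> real) \<Rightarrow> ennreal" where
  "lorentz_avg_norm p r M f = lorentz_functional p r (rearr_avg M f)"

text \<open>
  Functions on a measurable set \<open>A\<close> are represented by functions on the whole space whose values
  outside \<open>A\<close> play no role, measurable with respect to Lebesgue measure on \<open>A\<close>. Instead of forming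
  classes modulo null sets, definiteness of a norm is stated up to null sets.
\<close>

definition finite_space ::
  "('a measure \<Rightarrow> ('a \<Rightarrow> real) \<Rightarrow> ennreal) \<Rightarrow> ('a::euclidean_space) set \<Rightarrow> ('a \<Rightarrow> real) set" where
  "finite_space \<nu> A = {f \<in> borel_measurable (lebesgue_on A). \<nu> (lebesgue_on A) f < \<infinity>}"

definition lorentz_space ::
  "ennreal \<Rightarrow> ennreal \<Rightarrow> ('a::euclidean_space) set \<Rightarrow> ('a \<Rightarrow> real) set" where
  "lorentz_space p r A = finite_space (lorentz_norm p r) A"

definition lorentz_avg_space ::
  "ennreal \<Rightarrow> ennreal \<Rightarrow> ('a::euclidean_space) set \<Rightarrow> ('a \<Rightarrow> real) set" where
  "lorentz_avg_space p r A = finite_space (lorentz_avg_norm p r) A"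

section \<open>Lorentz-Herz spaces\<close>

definition shell :: "('a::euclidean_space) set \<Rightarrow> int \<Rightarrow> 'a set" where
  "shell \<Omega> k =
     (if k = -1 then {\<omega> \<in> \<Omega>. norm \<omega> < 1 / 2}
      else {\<omega> \<in> \<Omega>. 2 powi (k - 1) \<le> norm \<omega> \<and> norm \<omega> < 2 powi k})"

definition cut :: "('a::euclidean_space) set \<Rightarrow> int \<Rightarrow> ('a \<Rightarrow> real) \<Rightarrow> 'a \<Rightarrow> real" where
  "cut \<Omega> k f = (\<lambda>x. f x * indicator (shell \<Omega> k) x)"

text \<open>\<open>\<nu>\<close> is the family of local norms, one for each underlying measure space.\<close>

definition herz_norm ::
  "('a measure \<Rightarrow> ('a \<Rightarrow> real) \<Rightarrow> ennreal) \<Rightarrow> real \<Rightarrow> ennreal \<Rightarrow> ('a::euclidean_space) set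
     \<Rightarrow> ('a \<Rightarrow> real) \<Rightarrow> ennreal" where
  "herz_norm \<nu> a q \<Omega> f =
     (if q = \<infinity>
      then (SUP k\<in>{-1..}. ennreal (2 powr (real_of_int k * a))
              * \<nu> (lebesgue_on (shell \<Omega> k)) (cut \<Omega> k f))
      else enn_powr
             (\<Sum>\<^sub>\<infinity>k\<in>{-1..}. ennreal (2 powr (real_of_int k * a * enn2real q))
                * enn_powr (\<nu> (lebesgue_on (shell \<Omega> k)) (cut \<Omega> k f)) (enn2real q))
             (1 / enn2real q))"

definition herz_space ::
  "('a measure \<Rightarrow> ('a \<Rightarrow> real) \<Rightarrow> ennreal) \<Rightarrow> real \<Rightarrow> ennreal \<Rightarrow> ('a::euclidean_space) set
     \<Rightarrow> ('a \<Rightarrow> real) set" where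
  "herz_space \<nu> a q \<Omega> =
     {f \<in> borel_measurable (lebesgue_on \<Omega>).
        (\<forall>k\<ge>-1. cut \<Omega> k f \<in> finite_space \<nu> (shell \<Omega> k)) \<and> herz_norm \<nu> a q \<Omega> f < \<infinity>}"

definition HL_norm ::
  "ennreal \<Rightarrow> ennreal \<Rightarrow> real \<Rightarrow> ennreal \<Rightarrow> ('a::euclidean_space) set \<Rightarrow> ('a \<Rightarrow> real) \<Rightarrow> ennreal" where
  "HL_norm p r a q \<Omega> f = herz_norm (lorentz_norm p r) a q \<Omega> f"

definition HL_space ::
  "ennreal \<Rightarrow> ennreal \<Rightarrow> real \<Rightarrow> ennreal \<Rightarrow> ('a::euclidean_space) set \<Rightarrow> ('a \<Rightarrow> real) set" where
  "HL_space p r a q \<Omega> = herz_space (lorentz_norm p r) a q \<Omega>"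

definition HL_avg_norm ::
  "ennreal \<Rightarrow> ennreal \<Rightarrow> real \<Rightarrow> ennreal \<Rightarrow> ('a::euclidean_space) set \<Rightarrow> ('a \<Rightarrow> real) \<Rightarrow> ennreal" where
  "HL_avg_norm p r a q \<Omega> f = herz_norm (lorentz_avg_norm p r) a q \<Omega> f"

definition HL_avg_space ::
  "ennreal \<Rightarrow> ennreal \<Rightarrow> real \<Rightarrow> ennreal \<Rightarrow> ('a::euclidean_space) set \<Rightarrow> ('a \<Rightarrow> real) set" where
  "HL_avg_space p r a q \<Omega> = herz_space (lorentz_avg_norm p r) a q \<Omega>"

section \<open>Ideal spaces\<close>

text \<open>A space is a pair of a set \<open>F\<close> of functions on \<open>\<Omega>\<close> and a real-valued functional \<open>N\<close> on it.\<close>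

definition linear_subspace_L0 :: "('a::euclidean_space) set \<Rightarrow> ('a \<Rightarrow> real) set \<Rightarrow> bool" where
  "linear_subspace_L0 \<Omega> F \<longleftrightarrow>
     F \<subseteq> borel_measurable (lebesgue_on \<Omega>) \<and> (\<lambda>x. 0) \<in> F \<and>
     (\<forall>f\<in>F. \<forall>g\<in>F. (\<lambda>x. f x + g x) \<in> F) \<and> (\<forall>c. \<forall>f\<in>F. (\<lambda>x. c * f x) \<in> F)"

definition quasi_norm_on ::
  "('a::euclidean_space) set \<Rightarrow> ('a \<Rightarrow> real) set \<Rightarrow> (('a \<Rightarrow> real) \<Rightarrow> real) \<Rightarrow> bool" where
  "quasi_norm_on \<Omega> F N \<longleftrightarrow>
     (\<forall>f\<in>F. 0 \<le> N f \<and> (N f = 0 \<longleftrightarrow> (AE x in lebesgue_on \<Omega>. f x = 0))) \<and>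
     (\<forall>c. \<forall>f\<in>F. N (\<lambda>x. c * f x) = \<bar>c\<bar> * N f) \<and>
     (\<exists>C\<ge>1. \<forall>f\<in>F. \<forall>g\<in>F. N (\<lambda>x. f x + g x) \<le> C * (N f + N g))"

definition norm_on ::
  "('a::euclidean_space) set \<Rightarrow> ('a \<Rightarrow> real) set \<Rightarrow> (('a \<Rightarrow> real) \<Rightarrow> real) \<Rightarrow> bool" where
  "norm_on \<Omega> F N \<longleftrightarrow>
     (\<forall>f\<in>F. 0 \<le> N f \<and> (N f = 0 \<longleftrightarrow> (AE x in lebesgue_on \<Omega>. f x = 0))) \<and>
     (\<forall>c. \<forall>f\<in>F. N (\<lambda>x. c * f x) = \<bar>c\<bar> * N f) \<and>
     (\<forall>f\<in>F. \<forall>g\<in>F. N (\<lambda>x. f x + g x) \<le> N f + N g)"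

definition quasi_normed_ideal_space ::
  "('a::euclidean_space) set \<Rightarrow> ('a \<Rightarrow> real) set \<Rightarrow> (('a \<Rightarrow> real) \<Rightarrow> real) \<Rightarrow> bool" where
  "quasi_normed_ideal_space \<Omega> F N \<longleftrightarrow>
     linear_subspace_L0 \<Omega> F \<and> quasi_norm_on \<Omega> F N \<and>
     (\<forall>f\<in>borel_measurable (lebesgue_on \<Omega>). \<forall>g\<in>F.
        (AE x in lebesgue_on \<Omega>. \<bar>f x\<bar> \<le> \<bar>g x\<bar>) \<longrightarrow> f \<in> F \<and> N f \<le> N g) \<and>
     (\<exists>g\<in>F. \<forall>x\<in>\<Omega>. 0 < g x)"

definition complete_on :: "('a \<Rightarrow> real) set \<Rightarrow> (('a \<Rightarrow> real) \<Rightarrow> real) \<Rightarrow> bool" where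
  "complete_on F N \<longleftrightarrow>
     (\<forall>u :: nat \<Rightarrow> 'a \<Rightarrow> real.
        (\<forall>n. u n \<in> F) \<and>
        (\<forall>\<epsilon>>0. \<exists>n0. \<forall>m\<ge>n0. \<forall>n\<ge>n0. N (\<lambda>x. u m x - u n x) < \<epsilon>) \<longrightarrow>
        (\<exists>f\<in>F. (\<lambda>n. N (\<lambda>x. u n x - f x)) \<longlonglongrightarrow> 0))"

definition quasi_Banach_ideal_space ::
  "('a::euclidean_space) set \<Rightarrow> ('a \<Rightarrow> real) set \<Rightarrow> (('a \<Rightarrow> real) \<Rightarrow> real) \<Rightarrow> bool" where
  "quasi_Banach_ideal_space \<Omega> F N \<longleftrightarrow> quasi_normed_ideal_space \<Omega> F N \<and> complete_on F N"

definition Banach_ideal_space ::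
  "('a::euclidean_space) set \<Rightarrow> ('a \<Rightarrow> real) set \<Rightarrow> (('a \<Rightarrow> real) \<Rightarrow> real) \<Rightarrow> bool" where
  "Banach_ideal_space \<Omega> F N \<longleftrightarrow>
     quasi_normed_ideal_space \<Omega> F N \<and> complete_on F N \<and> norm_on \<Omega> F N"

definition Fatou_property ::
  "('a::euclidean_space) set \<Rightarrow> ('a \<Rightarrow> real) set \<Rightarrow> (('a \<Rightarrow> real) \<Rightarrow> real) \<Rightarrow> bool" where
  "Fatou_property \<Omega> F N \<longleftrightarrow>
     (\<forall>f\<in>borel_measurable (lebesgue_on \<Omega>). \<forall>u :: nat \<Rightarrow> 'a \<Rightarrow> real.
        (\<forall>n. u n \<in> F \<and> (AE x in lebesgue_on \<Omega>. 0 \<le> u n x)) \<and>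
        (AE x in lebesgue_on \<Omega>. incseq (\<lambda>n. u n x) \<and> (\<lambda>n. u n x) \<longlonglongrightarrow> \<bar>f x\<bar>) \<and>
        bdd_above (range (\<lambda>n. N (u n))) \<longrightarrow>
        f \<in> F \<and> (\<lambda>n. N (u n)) \<longlonglongrightarrow> N f)"

end

theory Submission
  imports Defs
begin

text \<open>
  The axioms of a quasi-normed ideal space with the Fatou property are conveniently checked for
  functionals with values in \<open>[0, \<infinity>]\<close> defined on all measurable functions: monotone, absolutely
  homogeneous, definite, subadditive up to a factor \<open>C\<close>, and lower semicontinuous along increasing
  sequences (locale \<open>function_quasi_norm\<close>). The functions on which such a functional is finite form
  a quasi-Banach ideal space with the Fatou property as soon as they include a strictly positive
  function (\<open>function_quasi_norm_imp_ideal_space\<close>), and \<open>C = 1\<close> gives a Banach space.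
  Completeness is a consequence of the Fatou property: along a rapidly converging subsequence the
  sums of the absolute increments have bounded quasi-norm, hence are finite almost everywhere.

  The Lorentz functional and the outer sum over the shells are both instances of \<open>Lr_norm\<close>, for the
  measure \<open>dt / t\<close> on the half line and for counting measure. This functional is a norm for
  exponents at least \<open>1\<close>, a quasi-norm otherwise, and it commutes with increasing limits. The
  passage from the shells to \<open>\<Omega>\<close> (\<open>herz_function_quasi_norm\<close>) therefore only needs local quasi-norms
  whose constant \<open>C\<close> does not depend on the shell, and the local positive functions can be scaled
  and glued.

  All properties of \<open>f\<^sup>*\<close> follow from the equivalence \<open>f\<^sup>*(t) \<le> l \<longleftrightarrow> \<mu>{\<bar>f\<bar> > l} \<le> t\<close>
  (\<open>rearr_le_iff\<close>). What remains is subadditivity, which has three sources.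

  \<^item> \<open>(f + g)\<^sup>*(t) \<le> f\<^sup>*(t/2) + g\<^sup>*(t/2)\<close>, together with the scaling behaviour of the
    Lorentz functional, gives the quasi-triangle inequality for \<open>f\<^sup>*\<close>.

  \<^item> \<open>t f\<^sup>*\<^sup>*(t)\<close> is the minimum over \<open>l \<ge> 0\<close> of \<open>l t + \<integral>(\<bar>f\<bar> - l)\<^sub>+\<close>, and this expression is
    visibly subadditive in \<open>f\<close>; so \<open>(f + g)\<^sup>*\<^sup>* \<le> f\<^sup>*\<^sup>* + g\<^sup>*\<^sup>*\<close> (\<open>integral_rearr_add\<close>), and the averaged
    functional inherits the triangle inequality of \<open>Lr_norm\<close>.

  \<^item> For \<open>1 \<le> r \<le> p\<close> the weight \<open>t\<^bsup>r/p - 1\<^esup>\<close> is decreasing, and Hardy's lemma transfers the previous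
    inequality between integrals over \<open>(0, t)\<close> to the Lorentz functionals of \<open>(f + g)\<^sup>*\<close> and of
    \<open>f\<^sup>* + g\<^sup>*\<close> (\<open>lorentz_functional_le_of_integrals_le\<close>).
\<close>

section \<open>Powers of extended nonnegative reals\<close>

lemma enn_powr_ennreal: "0 \<le> x \<Longrightarrow> enn_powr (ennreal x) s = ennreal (x powr s)"
  by (simp add: enn_powr_def)

lemma enn_powr_top [simp]: "enn_powr top s = top"
  by (simp add: enn_powr_def)

lemma enn_powr_0 [simp]: "enn_powr 0 s = 0"
  by (simp add: enn_powr_def)

lemma enn_powr_one [simp]: "enn_powr x 1 = x"
  by (cases x) (simp_all add: enn_powr_ennreal)

lemma enn_powr_enn_powr: "enn_powr (enn_powr x s) t = enn_powr x (s * t)"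
  by (cases x) (simp_all add: enn_powr_ennreal powr_powr)

lemma enn_powr_mult:
  assumes "s > 0"
  shows "enn_powr (x * y) s = enn_powr x s * enn_powr y s"
proof (cases "x = 0 \<or> y = 0")
  case True
  then show ?thesis by auto
next
  case False
  show ?thesis
  proof (cases "x = top \<or> y = top")
    case True
    have pos: "enn_powr z s \<noteq> 0" if "z \<noteq> 0" for z
      using that by (cases z) (auto simp: enn_powr_ennreal ennreal_eq_0_iff)
    from True False pos[of x] pos[of y] show ?thesis
      by (auto simp: ennreal_mult_top ennreal_top_mult)
  next
    case False
    then obtain a b where "x = ennreal a" "y = ennreal b" "0 \<le> a" "0 \<le> b"
      by (metis enn2real_nonneg ennreal_enn2real_if)
    then show ?thesis
      by (simp add: enn_powr_ennreal powr_mult flip: ennreal_mult)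
  qed
qed

lemma enn_powr_mono: "s > 0 \<Longrightarrow> x \<le> y \<Longrightarrow> enn_powr x s \<le> enn_powr y s"
  by (cases x; cases y) (auto simp: enn_powr_ennreal top_unique powr_mono2 intro!: ennreal_leI)

lemma enn_powr_inverse [simp]:
  assumes "s > 0"
  shows "enn_powr (enn_powr x s) (1 / s) = x" "enn_powr (enn_powr x (1 / s)) s = x"
  using assms by (simp_all add: enn_powr_enn_powr)

text \<open>
  The powers with exponents \<open>s\<close> and \<open>1 / s\<close> are mutually inverse and monotone. Stated as an
  adjunction, this yields at once that powers commute with suprema.
\<close>

lemma enn_powr_le_iff: "s > 0 \<Longrightarrow> enn_powr x s \<le> y \<longleftrightarrow> x \<le> enn_powr y (1 / s)"
  by (metis enn_powr_inverse enn_powr_mono divide_pos_pos zero_less_one)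

lemma enn_powr_eq_0_iff: "s > 0 \<Longrightarrow> enn_powr x s = 0 \<longleftrightarrow> x = 0"
  by (metis enn_powr_0 enn_powr_inverse(1))

lemma enn_powr_eq_top_iff: "enn_powr x s = top \<longleftrightarrow> x = top"
  by (simp add: enn_powr_def)

lemma enn_powr_less_top_iff: "enn_powr x s < top \<longleftrightarrow> x < top"
  by (simp add: enn_powr_eq_top_iff flip: less_top)

lemma enn_powr_SUP:
  assumes "s > 0"
  shows "enn_powr (SUP i\<in>A. f i) s = (SUP i\<in>A. enn_powr (f i) s)"
proof (rule antisym)
  have "f i \<le> enn_powr (SUP i\<in>A. enn_powr (f i) s) (1 / s)" if "i \<in> A" for i
    using that by (subst enn_powr_le_iff[OF assms, symmetric]) (rule SUP_upper)
  then show "enn_powr (SUP i\<in>A. f i) s \<le> (SUP i\<in>A. enn_powr (f i) s)"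
    by (subst enn_powr_le_iff[OF assms]) (rule SUP_least)
  show "(SUP i\<in>A. enn_powr (f i) s) \<le> enn_powr (SUP i\<in>A. f i) s"
    by (intro SUP_least enn_powr_mono assms SUP_upper)
qed

lemma measurable_enn_powr [measurable]: "(\<lambda>x. enn_powr x s) \<in> borel_measurable borel"
  unfolding enn_powr_def by measurable

lemma powr_sum_le:
  fixes x y :: real
  assumes "0 \<le> x" "0 \<le> y" "0 < s"
  shows "(x + y) powr s \<le> 2 powr s * (x powr s + y powr s)"
proof -
  have "(x + y) powr s \<le> (2 * max x y) powr s"
    using assms by (intro powr_mono2) auto
  also have "\<dots> = 2 powr s * (max x y) powr s"
    using assms by (simp add: powr_mult)
  also have "\<dots> \<le> 2 powr s * (x powr s + y powr s)"
    by (intro mult_left_mono) (auto simp: max_def)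
  finally show ?thesis .
qed

lemma enn_powr_sum_le:
  assumes "0 < s"
  shows "enn_powr (x + y) s \<le> ennreal (2 powr s) * (enn_powr x s + enn_powr y s)"
proof (cases x; cases y)
  fix a b assume "x = ennreal a" "y = ennreal b" "0 \<le> a" "0 \<le> b"
  then show ?thesis
    using powr_sum_le[of a b s] assms
    by (simp add: enn_powr_ennreal ennreal_leI flip: ennreal_plus ennreal_mult)
qed (auto simp: ennreal_mult_top)

lemma powr_convex_nonneg:
  assumes "1 \<le> r"
  shows "convex_on {0..} (\<lambda>x::real. x powr r)"
proof (rule convex_onI)
  fix t x y :: real
  assume t: "0 < t" "t < 1" and "x \<in> {0..}" "y \<in> {0..}"
  then have xy: "0 \<le> x" "0 \<le> y" by auto
  have scaled: "(c * z) powr r \<le> c * z powr r" if "0 < c" "c < 1" "0 \<le> z" for c z :: real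
    using powr_mono'[of 1 r c] that assms by (simp add: powr_mult mult_right_mono)
  consider "0 < x" "0 < y" | "x = 0" | "y = 0"
    using xy by linarith
  then show "((1 - t) *\<^sub>R x + t *\<^sub>R y) powr r \<le> (1 - t) * x powr r + t * y powr r"
  proof cases
    case 1
    then show ?thesis
      using convex_onD[OF powr_convex[OF assms], of t x y] t by simp
  qed (use t xy scaled[of t y] scaled[of "1 - t" x] in auto)
qed simp

text \<open>
  This is the pointwise form of Minkowski's inequality, with \<open>A\<close> and \<open>B\<close> standing for the norms of
  the two summands. It is convexity of \<open>x \<mapsto> x\<^sup>r\<close> at the point \<open>(x + y) / (A + B)\<close>, a convex combination of
  \<open>x / A\<close> and \<open>y / B\<close>.
\<close>

lemma powr_sum_le_weighted:
  fixes x y A B :: real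
  assumes "0 \<le> x" "0 \<le> y" "0 < A" "0 < B" "1 \<le> r"
  shows "(x + y) powr r \<le> (A + B) powr (r - 1) * (A powr (1 - r) * x powr r + B powr (1 - r) * y powr r)"
proof -
  note conv = powr_convex_nonneg[OF assms(5)]
  have weight: "1 - B / (A + B) = A / (A + B)"
    using assms by (simp add: field_simps)
  have "(1 - B / (A + B)) *\<^sub>R (x / A) = x / (A + B)" "(B / (A + B)) *\<^sub>R (y / B) = y / (A + B)"
    unfolding weight using assms by simp_all
  then have "((x + y) / (A + B)) powr r
      = ((1 - B / (A + B)) *\<^sub>R (x / A) + (B / (A + B)) *\<^sub>R (y / B)) powr r"
    by (simp add: add_divide_distrib)
  also have "\<dots> \<le> (1 - B / (A + B)) * (x / A) powr r + (B / (A + B)) * (y / B) powr r"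
    using assms by (intro convex_onD[OF conv]) (auto simp: field_simps)
  also note weight
  finally have "((x + y) / (A + B)) powr r \<le> A / (A + B) * (x / A) powr r + B / (A + B) * (y / B) powr r" .
  then have "(A + B) powr r * ((x + y) / (A + B)) powr r
     \<le> (A + B) powr r * (A / (A + B) * (x / A) powr r + B / (A + B) * (y / B) powr r)"
    by (rule mult_left_mono) simp
  also have "(A + B) powr r * ((x + y) / (A + B)) powr r = (x + y) powr r"
    using assms by (simp add: powr_divide)
  also have "(A + B) powr r * (A / (A + B) * (x / A) powr r + B / (A + B) * (y / B) powr r)
     = (A + B) powr (r - 1) * (A powr (1 - r) * x powr r + B powr (1 - r) * y powr r)"
    using assms by (simp add: powr_divide powr_diff distrib_left mult_ac)
  finally show ?thesis .
qed

lemma enn_powr_sum_le_weighted: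
  fixes A B :: real
  assumes "0 < A" "0 < B" "1 \<le> r"
  shows "enn_powr (x + y) r \<le> ennreal ((A + B) powr (r - 1)) *
     (ennreal (A powr (1 - r)) * enn_powr x r + ennreal (B powr (1 - r)) * enn_powr y r)"
proof (cases x; cases y)
  fix a b assume "x = ennreal a" "y = ennreal b" "0 \<le> a" "0 \<le> b"
  then show ?thesis
    using powr_sum_le_weighted[of a b A B r] assms
    by (simp add: enn_powr_ennreal ennreal_leI flip: ennreal_plus ennreal_mult)
qed (use assms in \<open>auto simp: ennreal_mult_top ennreal_top_mult\<close>)

section \<open>The functional of the Lebesgue space of exponent \<open>r\<close>\<close>

text \<open>
  A true supremum, not an essential one, represents the exponent \<open>\<infinity>\<close>, so that the functional
  agrees with the suprema over all \<open>t > 0\<close> and over all shells.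
\<close>

definition Lr_norm :: "'x measure \<Rightarrow> ennreal \<Rightarrow> ('x \<Rightarrow> ennreal) \<Rightarrow> ennreal" where
  "Lr_norm M r u =
     (if r = \<infinity> then (SUP x\<in>space M. u x)
      else enn_powr (\<integral>\<^sup>+x. enn_powr (u x) (enn2real r) \<partial>M) (1 / enn2real r))"

definition Lr_const :: "ennreal \<Rightarrow> real" where
  "Lr_const r = (if 1 \<le> r then 1 else 2 * 2 powr (1 / enn2real r))"

lemma Lr_const_ge_1: "1 \<le> Lr_const r"
proof -
  have "1 \<le> (2::real) powr (1 / enn2real r)"
    by (rule ge_one_powr_ge_zero) simp_all
  then show ?thesis by (simp add: Lr_const_def)
qed

lemma exponent_cases [consumes 1, case_names top finite]:
  fixes r :: ennreal
  assumes "0 < r"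
  obtains "r = \<infinity>" | s where "r \<noteq> \<infinity>" "enn2real r = s" "0 < s" "r = ennreal s"
  using assms by (cases r) auto

lemma Lr_norm_mono:
  assumes "0 < r" and "\<And>x. x \<in> space M \<Longrightarrow> u x \<le> v x"
  shows "Lr_norm M r u \<le> Lr_norm M r v"
  using assms(1)
proof (cases rule: exponent_cases)
  case top
  then show ?thesis by (auto simp: Lr_norm_def intro!: SUP_subset_mono assms)
next
  case (finite s)
  then show ?thesis
    by (auto simp: Lr_norm_def intro!: enn_powr_mono nn_integral_mono assms)
qed

lemma Lr_norm_cmult:
  assumes "0 < r" and [measurable]: "u \<in> borel_measurable M"
  shows "Lr_norm M r (\<lambda>x. c * u x) = c * Lr_norm M r u"
  using assms(1)
proof (cases rule: exponent_cases)
  case top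
  then show ?thesis by (simp add: Lr_norm_def SUP_mult_left_ennreal)
next
  case (finite s)
  then show ?thesis
    by (simp add: Lr_norm_def enn_powr_mult nn_integral_cmult)
qed

lemma Lr_norm_SUP:
  assumes "0 < r" and [measurable]: "\<And>n::nat. u n \<in> borel_measurable M"
    and inc: "\<And>x. x \<in> space M \<Longrightarrow> incseq (\<lambda>n. u n x)"
  shows "Lr_norm M r (\<lambda>x. SUP n. u n x) = (SUP n. Lr_norm M r (u n))"
  using assms(1)
proof (cases rule: exponent_cases)
  case top
  then show ?thesis by (simp add: Lr_norm_def SUP_commute[of _ UNIV])
next
  case (finite s)
  have "(\<integral>\<^sup>+x. enn_powr (SUP n. u n x) s \<partial>M) = (\<integral>\<^sup>+x. (SUP n. enn_powr (u n x) s) \<partial>M)"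
    using finite by (simp add: enn_powr_SUP)
  also have "\<dots> = (SUP n. \<integral>\<^sup>+x. enn_powr (u n x) s \<partial>M)"
    using finite inc by (intro nn_integral_monotone_convergence_SUP_AE AE_I2)
      (auto intro!: enn_powr_mono simp: incseq_Suc_iff)
  finally show ?thesis
    using finite by (simp add: Lr_norm_def enn_powr_SUP)
qed

lemma Lr_norm_eq_0:
  assumes "0 < r" and [measurable]: "u \<in> borel_measurable M" and "Lr_norm M r u = 0"
  shows "AE x in M. u x = 0"
  using assms(1)
proof (cases rule: exponent_cases)
  case top
  have "u x \<le> 0" if "x \<in> space M" for x
    using SUP_upper[OF that, of u] assms(3) top by (simp add: Lr_norm_def)
  then show ?thesis by (intro AE_I2) simp
next
  case (finite s)
  then show ?thesis
    using assms(3) by (simp add: Lr_norm_def enn_powr_eq_0_iff nn_integral_0_iff_AE)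
qed

text \<open>
  Minkowski's inequality. Integrating the pointwise bound with weights \<open>A\<close>, \<open>B\<close> at least as large as
  the two norms bounds the norm of the sum by \<open>A + B\<close>.
\<close>

lemma Lr_norm_finite_triangle:
  assumes "1 \<le> s"
    and [measurable]: "u \<in> borel_measurable M" "v \<in> borel_measurable M"
  shows "enn_powr (\<integral>\<^sup>+x. enn_powr (u x + v x) s \<partial>M) (1 / s)
     \<le> enn_powr (\<integral>\<^sup>+x. enn_powr (u x) s \<partial>M) (1 / s) + enn_powr (\<integral>\<^sup>+x. enn_powr (v x) s \<partial>M) (1 / s)"
    (is "?N (\<lambda>x. u x + v x) \<le> ?N u + ?N v")
proof (cases "?N u = top \<or> ?N v = top")
  case True
  then show ?thesis by auto
next
  case False
  then obtain U V where UV: "?N u = ennreal U" "?N v = ennreal V" "0 \<le> U" "0 \<le> V"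
    by (metis enn2real_nonneg ennreal_enn2real_if)
  have s: "0 < s" using assms(1) by simp
  have ub: "?N w \<le> ennreal A \<longleftrightarrow> (\<integral>\<^sup>+x. enn_powr (w x) s \<partial>M) \<le> ennreal (A powr s)" if "0 \<le> A" for w A
    using s that enn_powr_le_iff[of "1/s" "\<integral>\<^sup>+x. enn_powr (w x) s \<partial>M" "ennreal A"]
    by (simp add: enn_powr_ennreal)
  show ?thesis
  proof (rule ennreal_le_epsilon)
    fix e :: real assume "0 < e"
    \<comment> \<open>The margin keeps both weights positive when one of the norms vanishes.\<close>
    define A where "A = U + e / 2"
    define B where "B = V + e / 2"
    have pos: "0 < A" "0 < B" using \<open>0 < e\<close> UV by (simp_all add: A_def B_def)
    have Au: "?N u \<le> ennreal A" and Bv: "?N v \<le> ennreal B"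
      unfolding UV A_def B_def using \<open>0 < e\<close> by (auto intro!: ennreal_leI)
    have "(\<integral>\<^sup>+x. enn_powr (u x + v x) s \<partial>M)
      \<le> (\<integral>\<^sup>+x. ennreal ((A + B) powr (s - 1)) *
           (ennreal (A powr (1 - s)) * enn_powr (u x) s + ennreal (B powr (1 - s)) * enn_powr (v x) s) \<partial>M)"
      using pos assms(1) by (intro nn_integral_mono enn_powr_sum_le_weighted)
    also have "\<dots> = ennreal ((A + B) powr (s - 1)) *
       (ennreal (A powr (1 - s)) * (\<integral>\<^sup>+x. enn_powr (u x) s \<partial>M)
        + ennreal (B powr (1 - s)) * (\<integral>\<^sup>+x. enn_powr (v x) s \<partial>M))"
      by (simp add: nn_integral_cmult nn_integral_add)
    also have "\<dots> \<le> ennreal ((A + B) powr (s - 1)) *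
       (ennreal (A powr (1 - s)) * ennreal (A powr s) + ennreal (B powr (1 - s)) * ennreal (B powr s))"
      using Au Bv pos by (intro mult_left_mono add_mono) (simp_all add: ub)
    also have "\<dots> = ennreal ((A + B) powr (s - 1) * (A powr (1 - s) * A powr s + B powr (1 - s) * B powr s))"
      by (simp flip: ennreal_mult ennreal_plus)
    also have "(A + B) powr (s - 1) * (A powr (1 - s) * A powr s + B powr (1 - s) * B powr s)
        = (A + B) powr s"
      using pos by (simp add: powr_diff field_simps)
    finally have "?N (\<lambda>x. u x + v x) \<le> ennreal (A + B)"
      using pos ub[of "A + B" "\<lambda>x. u x + v x"] by (simp del: ennreal_plus)
    also have "\<dots> = ?N u + ?N v + ennreal e"
      using UV \<open>0 < e\<close> by (simp add: A_def B_def flip: ennreal_plus)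
    finally show "?N (\<lambda>x. u x + v x) \<le> ?N u + ?N v + ennreal e" .
  qed
qed

lemma Lr_norm_finite_quasi_triangle:
  assumes "0 < s"
    and [measurable]: "u \<in> borel_measurable M" "v \<in> borel_measurable M"
  shows "enn_powr (\<integral>\<^sup>+x. enn_powr (u x + v x) s \<partial>M) (1 / s)
     \<le> ennreal (2 * 2 powr (1 / s)) *
        (enn_powr (\<integral>\<^sup>+x. enn_powr (u x) s \<partial>M) (1 / s) + enn_powr (\<integral>\<^sup>+x. enn_powr (v x) s \<partial>M) (1 / s))"
proof -
  have "(\<integral>\<^sup>+x. enn_powr (u x + v x) s \<partial>M)
      \<le> (\<integral>\<^sup>+x. ennreal (2 powr s) * (enn_powr (u x) s + enn_powr (v x) s) \<partial>M)"
    by (intro nn_integral_mono enn_powr_sum_le assms)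
  also have "\<dots> = ennreal (2 powr s) * ((\<integral>\<^sup>+x. enn_powr (u x) s \<partial>M) + (\<integral>\<^sup>+x. enn_powr (v x) s \<partial>M))"
    by (simp add: nn_integral_cmult nn_integral_add)
  finally have "enn_powr (\<integral>\<^sup>+x. enn_powr (u x + v x) s \<partial>M) (1 / s)
     \<le> enn_powr (ennreal (2 powr s) * ((\<integral>\<^sup>+x. enn_powr (u x) s \<partial>M) + (\<integral>\<^sup>+x. enn_powr (v x) s \<partial>M))) (1 / s)"
    using assms(1) by (intro enn_powr_mono) simp_all
  also have "\<dots> = ennreal 2 * enn_powr ((\<integral>\<^sup>+x. enn_powr (u x) s \<partial>M) + (\<integral>\<^sup>+x. enn_powr (v x) s \<partial>M)) (1 / s)"
    using assms(1) by (simp add: enn_powr_mult enn_powr_ennreal powr_powr)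
  also have "\<dots> \<le> ennreal 2 * (ennreal (2 powr (1 / s)) *
        (enn_powr (\<integral>\<^sup>+x. enn_powr (u x) s \<partial>M) (1 / s) + enn_powr (\<integral>\<^sup>+x. enn_powr (v x) s \<partial>M) (1 / s)))"
    using assms(1) by (intro mult_left_mono enn_powr_sum_le) simp_all
  finally show ?thesis
    by (simp add: ennreal_mult mult.assoc)
qed

lemma Lr_norm_add:
  assumes "0 < r" and "u \<in> borel_measurable M" "v \<in> borel_measurable M"
  shows "Lr_norm M r (\<lambda>x. u x + v x) \<le> ennreal (Lr_const r) * (Lr_norm M r u + Lr_norm M r v)"
  using assms(1)
proof (cases rule: exponent_cases)
  case top
  then show ?thesis
    by (auto simp: Lr_norm_def Lr_const_def intro!: SUP_least add_mono SUP_upper)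
next
  case (finite s)
  then show ?thesis
    using Lr_norm_finite_triangle[OF _ assms(2,3), of s] Lr_norm_finite_quasi_triangle[OF _ assms(2,3), of s]
    by (auto simp: Lr_norm_def Lr_const_def)
qed

section \<open>The decreasing rearrangement\<close>

abbreviation distribution :: "'a measure \<Rightarrow> ('a \<Rightarrow> real) \<Rightarrow> real \<Rightarrow> ennreal" where
  "distribution M f l \<equiv> emeasure M {x \<in> space M. l < \<bar>f x\<bar>}"

lemma distribution_antimono:
  assumes [measurable]: "f \<in> borel_measurable M" and "l \<le> l'"
  shows "distribution M f l' \<le> distribution M f l"
  using assms(2) by (intro emeasure_mono) auto

lemma ennreal_le_via_real_bounds:
  fixes x y :: ennreal
  assumes "\<And>l. 0 \<le> l \<Longrightarrow> y \<le> ennreal l \<Longrightarrow> x \<le> ennreal l"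
  shows "x \<le> y"
  using assms by (cases y) auto

text \<open>
  The rearrangement is the generalized inverse of the distribution function. The infimum in its
  definition is attained because the distribution function is continuous from the right.
\<close>

lemma rearr_le_iff:
  assumes [measurable]: "f \<in> borel_measurable M" and l: "0 \<le> l"
  shows "rearr M f t \<le> ennreal l \<longleftrightarrow> distribution M f l \<le> ennreal t"
proof
  assume le: "rearr M f t \<le> ennreal l"
  have step: "distribution M f (l + 1 / real (Suc n)) \<le> ennreal t" for n
  proof -
    have "rearr M f t < ennreal (l + 1 / real (Suc n))"
      by (rule le_less_trans[OF le]) (use l in \<open>simp add: ennreal_less_iff\<close>)
    then obtain l' where l': "0 < l'" "distribution M f l' \<le> ennreal t" "ennreal l' < ennreal (l + 1 / real (Suc n))"
      unfolding rearr_def by (auto simp: INF_less_iff)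
    then have "l' \<le> l + 1 / real (Suc n)" by (simp add: ennreal_less_iff)
    then show ?thesis using l'(2) distribution_antimono[OF assms(1)] order.trans by blast
  qed
  have "{x \<in> space M. l < \<bar>f x\<bar>} = (\<Union>n. {x \<in> space M. l + 1 / real (Suc n) < \<bar>f x\<bar>})"
  proof (intro set_eqI iffI)
    fix x assume "x \<in> {x \<in> space M. l < \<bar>f x\<bar>}"
    then have x: "x \<in> space M" "0 < \<bar>f x\<bar> - l" by auto
    then obtain n where "inverse (real (Suc n)) < \<bar>f x\<bar> - l"
      using reals_Archimedean by blast
    then show "x \<in> (\<Union>n. {x \<in> space M. l + 1 / real (Suc n) < \<bar>f x\<bar>})"
      using x by (auto simp: field_simps)
  next
    fix x assume "x \<in> (\<Union>n. {x \<in> space M. l + 1 / real (Suc n) < \<bar>f x\<bar>})"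
    then obtain n where "x \<in> space M" "l + 1 / real (Suc n) < \<bar>f x\<bar>" by auto
    moreover have "0 < 1 / real (Suc n)" by simp
    ultimately show "x \<in> {x \<in> space M. l < \<bar>f x\<bar>}" by (smt (verit) mem_Collect_eq)
  qed
  also have "emeasure M \<dots> = (SUP n. distribution M f (l + 1 / real (Suc n)))"
  proof (rule SUP_emeasure_incseq[symmetric])
    show "incseq (\<lambda>n. {x \<in> space M. l + 1 / real (Suc n) < \<bar>f x\<bar>})"
    proof (rule incseq_SucI, safe)
      fix n x assume "l + 1 / real (Suc n) < \<bar>f x\<bar>"
      moreover have "1 / real (Suc (Suc n)) \<le> 1 / real (Suc n)" by (simp add: frac_le)
      ultimately show "l + 1 / real (Suc (Suc n)) < \<bar>f x\<bar>" by linarith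
    qed
  qed auto
  also have "\<dots> \<le> ennreal t" by (intro SUP_least step)
  finally show "distribution M f l \<le> ennreal t" .
next
  assume le: "distribution M f l \<le> ennreal t"
  show "rearr M f t \<le> ennreal l"
  proof (rule ennreal_le_epsilon)
    fix e :: real assume "0 < e"
    then have "distribution M f (l + e) \<le> ennreal t"
      using distribution_antimono[OF assms(1), of l "l + e"] le by (intro order.trans[OF _ le]) simp
    then have "rearr M f t \<le> ennreal (l + e)"
      unfolding rearr_def using \<open>0 < e\<close> l by (intro INF_lower) simp
    then show "rearr M f t \<le> ennreal l + ennreal e" using \<open>0 < e\<close> l by simp
  qed
qed

lemma less_rearr_iff:
  assumes "f \<in> borel_measurable M" and "0 \<le> l"
  shows "ennreal l < rearr M f t \<longleftrightarrow> ennreal t < distribution M f l"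
  using rearr_le_iff[OF assms, of t] by (auto simp: not_le[symmetric])

lemma measurable_rearr [measurable]:
  assumes "f \<in> borel_measurable M"
  shows "rearr M f \<in> borel_measurable borel"
proof (rule borel_measurableI_le)
  fix y :: ennreal
  show "{t \<in> space borel. rearr M f t \<le> y} \<in> sets borel"
  proof (cases y)
    case (real l)
    then have "{t \<in> space borel. rearr M f t \<le> y} = {t \<in> space borel. distribution M f l \<le> ennreal t}"
      using rearr_le_iff[OF assms] by simp
    also have "\<dots> \<in> sets borel" by measurable
    finally show ?thesis .
  qed simp
qed

lemma rearr_antimono: "s \<le> t \<Longrightarrow> rearr M f t \<le> rearr M f s"
  unfolding rearr_def by (intro INF_superset_mono) (auto intro: order.trans ennreal_leI)

lemma rearr_mono_AE:
  assumes [measurable]: "f \<in> borel_measurable M" "g \<in> borel_measurable M"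
    and "AE x in M. \<bar>f x\<bar> \<le> \<bar>g x\<bar>"
  shows "rearr M f t \<le> rearr M g t"
proof -
  have "distribution M f l \<le> distribution M g l" for l
    using assms(3) by (intro emeasure_mono_AE) auto
  then show ?thesis
    unfolding rearr_def by (intro INF_superset_mono) (auto intro: order.trans)
qed

lemma rearr_cmult:
  assumes [measurable]: "f \<in> borel_measurable M"
  shows "rearr M (\<lambda>x. c * f x) t = ennreal \<bar>c\<bar> * rearr M f t"
proof (cases "c = 0")
  case True
  have "rearr M (\<lambda>x. 0) t \<le> ennreal 0" by (subst rearr_le_iff) auto
  then show ?thesis using True by simp
next
  case False
  then have c: "0 < \<bar>c\<bar>" by simp
  have iff: "rearr M (\<lambda>x. c * f x) t \<le> ennreal l \<longleftrightarrow> rearr M f t \<le> ennreal (l / \<bar>c\<bar>)" if "0 \<le> l" for l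
    using c that by (simp add: rearr_le_iff abs_mult divide_less_eq mult.commute)
  have div: "x \<le> ennreal (l / \<bar>c\<bar>) \<longleftrightarrow> ennreal \<bar>c\<bar> * x \<le> ennreal l" if "0 \<le> l" for x l
    using c that by (cases x) (auto simp: ennreal_mult_top top_unique pos_le_divide_eq mult.commute simp flip: ennreal_mult)
  show ?thesis
    by (rule antisym; rule ennreal_le_via_real_bounds) (simp_all add: iff div)
qed

text \<open>
  Where \<open>\<bar>f + g\<bar> > l + m\<close>, either \<open>\<bar>f\<bar> > l\<close> or \<open>\<bar>g\<bar> > m\<close>; with \<open>l = f\<^sup>*(s)\<close> and \<open>m = g\<^sup>*(t)\<close>
  the two sets have measure at most \<open>s\<close> and \<open>t\<close>.
\<close>

lemma rearr_add:
  assumes [measurable]: "f \<in> borel_measurable M" "g \<in> borel_measurable M" and "0 \<le> s" "0 \<le> t"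
  shows "rearr M (\<lambda>x. f x + g x) (s + t) \<le> rearr M f s + rearr M g t"
proof (cases "rearr M f s"; cases "rearr M g t")
  fix l m assume lm: "rearr M f s = ennreal l" "rearr M g t = ennreal m" "0 \<le> l" "0 \<le> m"
  have "distribution M (\<lambda>x. f x + g x) (l + m)
     \<le> emeasure M ({x \<in> space M. l < \<bar>f x\<bar>} \<union> {x \<in> space M. m < \<bar>g x\<bar>})"
    by (intro emeasure_mono) auto
  also have "\<dots> \<le> distribution M f l + distribution M g m"
    by (intro emeasure_subadditive) auto
  also have "\<dots> \<le> ennreal s + ennreal t"
    using lm by (intro add_mono) (simp_all flip: rearr_le_iff)
  finally have "rearr M (\<lambda>x. f x + g x) (s + t) \<le> ennreal (l + m)"
    using lm assms(3,4) by (simp add: rearr_le_iff del: ennreal_plus flip: ennreal_plus)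
  then show ?thesis using lm by simp
qed auto

text \<open>
  If \<open>u\<^sub>n\<close> increases to \<open>\<bar>f\<bar>\<close>, then the sets \<open>{u\<^sub>n > l}\<close> increase to \<open>{\<bar>f\<bar> > l}\<close> up to a null set, so the
  distribution functions converge.
\<close>

lemma rearr_Fatou:
  assumes [measurable]: "f \<in> borel_measurable M" "\<And>n. u n \<in> borel_measurable M"
    and inc: "AE x in M. incseq (\<lambda>n. u n x) \<and> (\<lambda>n. u n x) \<longlonglongrightarrow> \<bar>f x\<bar>"
    and pos: "\<And>n. AE x in M. 0 \<le> u n x"
  shows "rearr M f t \<le> (SUP n. rearr M (u n) t)"
proof (rule ennreal_le_via_real_bounds)
  fix l assume l: "0 \<le> l" "(SUP n. rearr M (u n) t) \<le> ennreal l"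
  have pos': "AE x in M. \<forall>n. 0 \<le> u n x" using pos by (simp add: AE_all_countable)
  have "distribution M f l = (\<integral>\<^sup>+x. indicator {x \<in> space M. l < \<bar>f x\<bar>} x \<partial>M)" by simp
  also have "\<dots> \<le> (\<integral>\<^sup>+x. (SUP n. indicator {x \<in> space M. l < \<bar>u n x\<bar>} x) \<partial>M)"
  proof (rule nn_integral_mono_AE)
    show "AE x in M. indicator {x \<in> space M. l < \<bar>f x\<bar>} x
        \<le> (SUP n. indicator {x \<in> space M. l < \<bar>u n x\<bar>} x :: ennreal)"
      using inc pos' AE_space
    proof eventually_elim
      case x: (elim x)
      show ?case
      proof (cases "l < \<bar>f x\<bar>")
        case True
        with x(1) have "eventually (\<lambda>n. l < u n x) sequentially" by (auto intro: order_tendstoD)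
        then obtain n where "l < u n x" by (auto simp: eventually_sequentially)
        then have "indicator {x \<in> space M. l < \<bar>u n x\<bar>} x = (1::ennreal)" using x by auto
        then show ?thesis using True x(3) by (intro SUP_upper2[of n]) auto
      qed simp
    qed
  qed
  also have "\<dots> = (SUP n. \<integral>\<^sup>+x. indicator {x \<in> space M. l < \<bar>u n x\<bar>} x \<partial>M)"
    by (rule nn_integral_monotone_convergence_SUP_AE, use inc pos' in eventually_elim)
      (auto simp: indicator_def incseq_Suc_iff intro: less_le_trans)
  also have "\<dots> = (SUP n. distribution M (u n) l)" by simp
  also have "\<dots> \<le> ennreal t"
    using l by (intro SUP_least) (simp add: SUP_le_iff flip: rearr_le_iff)
  finally show "rearr M f t \<le> ennreal l" using l by (simp add: rearr_le_iff)
qed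

lemma rearr_eq_0_imp_AE:
  assumes [measurable]: "f \<in> borel_measurable M" and "\<And>t. 0 < t \<Longrightarrow> rearr M f t = 0"
  shows "AE x in M. f x = 0"
proof -
  have "distribution M f 0 \<le> ennreal t" if "0 < t" for t
    using assms(2)[OF that] rearr_le_iff[OF assms(1), of 0 t] by simp
  then have "distribution M f 0 \<le> 0 + ennreal t" if "0 < t" for t
    using that by simp
  then have "distribution M f 0 \<le> 0" by (rule ennreal_le_epsilon)
  then have "emeasure M {x \<in> space M. f x \<noteq> 0} = 0" by simp
  then show ?thesis by (subst AE_iff_measurable[OF _ refl]) auto
qed

section \<open>The averaged rearrangement\<close>

lemma emeasure_lborel_Ioi: "emeasure lborel {a::real<..} = top"
proof -
  have "ennreal (real n) \<le> emeasure lborel {a<..}" for n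
    using emeasure_mono[of "{a<..<a + real n}" "{a<..}" lborel] by (simp add: subset_eq)
  then show ?thesis
    using ennreal_SUP_of_nat_eq_top by (metis SUP_least ennreal_of_nat_eq_real_of_nat top_unique)
qed

lemma emeasure_layers:
  assumes "0 \<le> a"
  shows "emeasure lborel {l. a < l \<and> ennreal l < x} = x - ennreal a"
proof (cases x)
  case (real b)
  then have "{l. a < l \<and> ennreal l < x} = {a<..<b}"
    using assms by (auto simp: ennreal_less_iff)
  then have "emeasure lborel {l. a < l \<and> ennreal l < x} = emeasure lborel {a<..<b}" by simp
  then show ?thesis using real assms
    by (cases "a \<le> b") (simp_all add: ennreal_minus ennreal_neg)
next
  case top
  then show ?thesis
    using emeasure_lborel_Ioi[of a] assms by (simp add: greaterThan_def)
qed

text \<open>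
  Both sides are the integral over \<open>l > a\<close> of the common distribution function of \<open>f\<close> and \<open>f\<^sup>*\<close>.
\<close>

lemma nn_integral_rearr_excess:
  assumes "sigma_finite_measure M" and [measurable]: "f \<in> borel_measurable M" and a: "0 \<le> a"
  shows "(\<integral>\<^sup>+t\<in>{0<..}. (rearr M f t - ennreal a) \<partial>lborel) = (\<integral>\<^sup>+x. ennreal \<bar>f x\<bar> - ennreal a \<partial>M)"
proof -
  interpret M: sigma_finite_measure M by fact
  interpret LM: pair_sigma_finite lborel M ..
  have "(\<integral>\<^sup>+t\<in>{0<..}. (rearr M f t - ennreal a) \<partial>lborel)
    = (\<integral>\<^sup>+t. (\<integral>\<^sup>+l. (if 0 < t \<and> a < l \<and> ennreal l < rearr M f t then 1 else 0) \<partial>lborel) \<partial>lborel)"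
  proof (rule nn_integral_cong)
    fix t :: real
    have "(\<integral>\<^sup>+l. (if 0 < t \<and> a < l \<and> ennreal l < rearr M f t then 1 else 0) \<partial>lborel)
      = (\<integral>\<^sup>+l. indicator {l. a < l \<and> ennreal l < rearr M f t} l * indicator {0<..} t \<partial>lborel)"
      by (rule nn_integral_cong) auto
    also have "\<dots> = (rearr M f t - ennreal a) * indicator {0<..} t"
      using a by (simp add: nn_integral_multc emeasure_layers)
    finally show "(rearr M f t - ennreal a) * indicator {0<..} t
       = (\<integral>\<^sup>+l. (if 0 < t \<and> a < l \<and> ennreal l < rearr M f t then 1 else 0) \<partial>lborel)" by simp
  qed
  also have "\<dots> = (\<integral>\<^sup>+l. (\<integral>\<^sup>+t. (if 0 < t \<and> a < l \<and> ennreal l < rearr M f t then 1 else 0) \<partial>lborel) \<partial>lborel)"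
    by (rule lborel_pair.Fubini'[symmetric]) measurable
  also have "\<dots> = (\<integral>\<^sup>+l. (\<integral>\<^sup>+x. (if a < l \<and> l < \<bar>f x\<bar> then 1 else 0) \<partial>M) \<partial>lborel)"
  proof (rule nn_integral_cong)
    fix l :: real
    have "(\<integral>\<^sup>+t. (if 0 < t \<and> a < l \<and> ennreal l < rearr M f t then 1 else 0) \<partial>lborel)
      = (\<integral>\<^sup>+t. indicator {t. 0 < t \<and> ennreal t < distribution M f l} t * indicator {a<..} l \<partial>lborel)"
      by (rule nn_integral_cong) (use a in \<open>auto simp: less_rearr_iff\<close>)
    also have "\<dots> = distribution M f l * indicator {a<..} l"
      using emeasure_layers[of 0] by (simp add: nn_integral_multc)
    also have "\<dots> = (\<integral>\<^sup>+x. indicator {x \<in> space M. l < \<bar>f x\<bar>} x * indicator {a<..} l \<partial>M)"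
      by (simp add: nn_integral_multc)
    also have "\<dots> = (\<integral>\<^sup>+x. (if a < l \<and> l < \<bar>f x\<bar> then 1 else 0) \<partial>M)"
      by (rule nn_integral_cong) auto
    finally show "(\<integral>\<^sup>+t. (if 0 < t \<and> a < l \<and> ennreal l < rearr M f t then 1 else 0) \<partial>lborel) = \<dots>" .
  qed
  also have "\<dots> = (\<integral>\<^sup>+x. (\<integral>\<^sup>+l. (if a < l \<and> l < \<bar>f x\<bar> then 1 else 0) \<partial>lborel) \<partial>M)"
    by (rule LM.Fubini'[symmetric]) measurable
  also have "\<dots> = (\<integral>\<^sup>+x. ennreal \<bar>f x\<bar> - ennreal a \<partial>M)"
  proof (rule nn_integral_cong)
    fix x
    have "(\<integral>\<^sup>+l. (if a < l \<and> l < \<bar>f x\<bar> then 1 else 0) \<partial>lborel)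
      = (\<integral>\<^sup>+l. indicator {l. a < l \<and> ennreal l < ennreal \<bar>f x\<bar>} l \<partial>lborel)"
      by (rule nn_integral_cong) (use a in \<open>auto simp: ennreal_less_iff\<close>)
    then show "(\<integral>\<^sup>+l. (if a < l \<and> l < \<bar>f x\<bar> then 1 else 0) \<partial>lborel) = ennreal \<bar>f x\<bar> - ennreal a"
      using a by (simp add: emeasure_layers)
  qed
  finally show ?thesis .
qed

lemma nn_integral_Ioo_const:
  "0 < t \<Longrightarrow> (\<integral>\<^sup>+s\<in>{0<..<t}. c \<partial>lborel) = c * ennreal t"
  by (simp add: nn_integral_cmult_indicator)

text \<open>
  The right-hand side, minimized over \<open>l\<close>, is Peetre's K-functional for the spaces \<open>L\<^sup>1\<close> and
  \<open>L\<^sup>\<infinity>\<close>: it splits \<open>\<bar>f\<bar>\<close> into the part above the level \<open>l\<close> and a part bounded by \<open>l\<close>.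
\<close>

lemma integral_rearr_le:
  assumes "sigma_finite_measure M" and [measurable]: "f \<in> borel_measurable M" and l: "0 \<le> l" and "0 < t"
  shows "(\<integral>\<^sup>+s\<in>{0<..<t}. rearr M f s \<partial>lborel)
    \<le> ennreal l * ennreal t + (\<integral>\<^sup>+x. ennreal \<bar>f x\<bar> - ennreal l \<partial>M)"
proof -
  have "(\<integral>\<^sup>+s\<in>{0<..<t}. rearr M f s \<partial>lborel)
    \<le> (\<integral>\<^sup>+s. ennreal l * indicator {0<..<t} s + (rearr M f s - ennreal l) * indicator {0<..} s \<partial>lborel)"
  proof (rule nn_integral_mono)
    fix s :: real
    have "rearr M f s \<le> ennreal l + (rearr M f s - ennreal l)"
      by (cases "ennreal l \<le> rearr M f s") (simp_all add: add_diff_self_ennreal)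
    then show "rearr M f s * indicator {0<..<t} s
       \<le> ennreal l * indicator {0<..<t} s + (rearr M f s - ennreal l) * indicator {0<..} s"
      by (auto simp: indicator_def)
  qed
  also have "\<dots> = ennreal l * ennreal t + (\<integral>\<^sup>+x. ennreal \<bar>f x\<bar> - ennreal l \<partial>M)"
    using assms by (simp add: nn_integral_add nn_integral_rearr_excess nn_integral_cmult_indicator)
  finally show ?thesis .
qed

text \<open>The level \<open>l = f\<^sup>*(t)\<close> attains the minimum, because \<open>f\<^sup>* \<ge> l\<close> before \<open>t\<close> and \<open>f\<^sup>* \<le> l\<close> after \<open>t\<close>.\<close>

lemma integral_rearr_attained:
  assumes "sigma_finite_measure M" and [measurable]: "f \<in> borel_measurable M" and l: "0 \<le> l" and "0 < t"
    and eq: "rearr M f t = ennreal l"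
  shows "(\<integral>\<^sup>+s\<in>{0<..<t}. rearr M f s \<partial>lborel)
    = ennreal l * ennreal t + (\<integral>\<^sup>+x. ennreal \<bar>f x\<bar> - ennreal l \<partial>M)"
proof -
  have "(\<integral>\<^sup>+s\<in>{0<..<t}. rearr M f s \<partial>lborel)
    = (\<integral>\<^sup>+s. ennreal l * indicator {0<..<t} s + (rearr M f s - ennreal l) * indicator {0<..} s \<partial>lborel)"
  proof (rule nn_integral_cong)
    fix s :: real
    consider "s \<le> 0" | "0 < s" "s < t" | "0 < s" "t \<le> s" by linarith
    then show "rearr M f s * indicator {0<..<t} s
       = ennreal l * indicator {0<..<t} s + (rearr M f s - ennreal l) * indicator {0<..} s"
    proof cases
      case 2
      then have "ennreal l \<le> rearr M f s" using rearr_antimono[of s t M f] eq by simp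
      then show ?thesis using 2 by (simp add: add_diff_inverse_ennreal)
    next
      case 3
      then have "rearr M f s \<le> ennreal l" using rearr_antimono[of t s M f] eq by simp
      then show ?thesis using 3 by (simp add: diff_eq_0_iff_ennreal le_less_trans)
    qed simp
  qed
  also have "\<dots> = ennreal l * ennreal t + (\<integral>\<^sup>+x. ennreal \<bar>f x\<bar> - ennreal l \<partial>M)"
    using assms by (simp add: nn_integral_add nn_integral_rearr_excess nn_integral_cmult_indicator)
  finally show ?thesis .
qed

lemma integral_rearr_ge:
  assumes [measurable]: "f \<in> borel_measurable M" and "0 < t"
  shows "rearr M f t * ennreal t \<le> (\<integral>\<^sup>+s\<in>{0<..<t}. rearr M f s \<partial>lborel)"
  unfolding nn_integral_Ioo_const[OF assms(2), symmetric]
  by (intro nn_integral_mono) (auto simp: indicator_def intro: rearr_antimono)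

text \<open>
  With the minimizing levels \<open>l\<close> for \<open>f\<close> and \<open>m\<close> for \<open>g\<close>, the level \<open>l + m\<close> is admissible for \<open>f + g\<close>,
  and \<open>(\<bar>f + g\<bar> - l - m)\<^sub>+ \<le> (\<bar>f\<bar> - l)\<^sub>+ + (\<bar>g\<bar> - m)\<^sub>+\<close>. If \<open>f\<^sup>*(t)\<close> or \<open>g\<^sup>*(t)\<close> is infinite, so is the
  right-hand side.
\<close>

lemma integral_rearr_add:
  assumes "sigma_finite_measure M" and [measurable]: "f \<in> borel_measurable M" "g \<in> borel_measurable M" and t: "0 < t"
  shows "(\<integral>\<^sup>+s\<in>{0<..<t}. rearr M (\<lambda>x. f x + g x) s \<partial>lborel)
    \<le> (\<integral>\<^sup>+s\<in>{0<..<t}. rearr M f s \<partial>lborel) + (\<integral>\<^sup>+s\<in>{0<..<t}. rearr M g s \<partial>lborel)"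
proof (cases "rearr M f t"; cases "rearr M g t")
  fix l m assume lm: "rearr M f t = ennreal l" "rearr M g t = ennreal m" "0 \<le> l" "0 \<le> m"
  have excess: "ennreal \<bar>f x + g x\<bar> - ennreal (l + m) \<le> (ennreal \<bar>f x\<bar> - ennreal l) + (ennreal \<bar>g x\<bar> - ennreal m)" for x
  proof -
    have "\<bar>f x + g x\<bar> - (l + m) \<le> max 0 (\<bar>f x\<bar> - l) + max 0 (\<bar>g x\<bar> - m)" by linarith
    then have "ennreal (\<bar>f x + g x\<bar> - (l + m)) \<le> ennreal (max 0 (\<bar>f x\<bar> - l)) + ennreal (max 0 (\<bar>g x\<bar> - m))"
      by (metis ennreal_leI ennreal_plus max.cobounded1)
    moreover have "ennreal (max 0 z) = ennreal z" for z by (simp add: max_def ennreal_neg)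
    ultimately show ?thesis using lm by (simp add: ennreal_minus del: ennreal_plus)
  qed
  have "(\<integral>\<^sup>+s\<in>{0<..<t}. rearr M (\<lambda>x. f x + g x) s \<partial>lborel)
    \<le> ennreal (l + m) * ennreal t + (\<integral>\<^sup>+x. ennreal \<bar>f x + g x\<bar> - ennreal (l + m) \<partial>M)"
    using lm t assms(1) by (intro integral_rearr_le) auto
  also have "\<dots> \<le> ennreal (l + m) * ennreal t
     + (\<integral>\<^sup>+x. (ennreal \<bar>f x\<bar> - ennreal l) + (ennreal \<bar>g x\<bar> - ennreal m) \<partial>M)"
    by (intro add_left_mono nn_integral_mono excess)
  also have "\<dots> = (ennreal l * ennreal t + (\<integral>\<^sup>+x. ennreal \<bar>f x\<bar> - ennreal l \<partial>M))
     + (ennreal m * ennreal t + (\<integral>\<^sup>+x. ennreal \<bar>g x\<bar> - ennreal m \<partial>M))"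
    using lm by (simp add: nn_integral_add distrib_right add_ac)
  also have "\<dots> = (\<integral>\<^sup>+s\<in>{0<..<t}. rearr M f s \<partial>lborel) + (\<integral>\<^sup>+s\<in>{0<..<t}. rearr M g s \<partial>lborel)"
    using lm t assms(1) by (simp add: integral_rearr_attained)
  finally show ?thesis .
qed (use integral_rearr_ge[of f M t] integral_rearr_ge[of g M t] t in \<open>simp_all add: ennreal_top_mult top_unique\<close>)

lemma measurable_rearr_avg [measurable]:
  assumes [measurable]: "f \<in> borel_measurable M"
  shows "rearr_avg M f \<in> borel_measurable borel"
proof -
  have "rearr_avg M f = (\<lambda>t. (\<integral>\<^sup>+s. (if 0 < s \<and> s < t then rearr M f s else 0) \<partial>lborel) / ennreal t)"
    unfolding rearr_avg_def
    by (intro ext arg_cong2[where f="(/)"] refl nn_integral_cong) auto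
  also have "\<dots> \<in> borel_measurable borel" by measurable
  finally show ?thesis .
qed

lemma rearr_avg_mono_AE:
  assumes "f \<in> borel_measurable M" "g \<in> borel_measurable M" "AE x in M. \<bar>f x\<bar> \<le> \<bar>g x\<bar>"
  shows "rearr_avg M f t \<le> rearr_avg M g t"
  unfolding rearr_avg_def using rearr_mono_AE[OF assms]
  by (intro divide_right_mono_ennreal nn_integral_mono mult_right_mono) auto

lemma rearr_avg_cmult:
  assumes [measurable]: "f \<in> borel_measurable M"
  shows "rearr_avg M (\<lambda>x. c * f x) t = ennreal \<bar>c\<bar> * rearr_avg M f t"
  by (simp add: rearr_avg_def rearr_cmult nn_integral_cmult mult.assoc ennreal_times_divide)

lemma rearr_le_rearr_avg:
  assumes "f \<in> borel_measurable M" and "0 < t"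
  shows "rearr M f t \<le> rearr_avg M f t"
proof -
  have "rearr M f t = rearr M f t * ennreal t / ennreal t"
    using assms by (simp add: ennreal_mult_divide_eq)
  also have "\<dots> \<le> rearr_avg M f t"
    unfolding rearr_avg_def by (intro divide_right_mono_ennreal integral_rearr_ge assms)
  finally show ?thesis .
qed

lemma rearr_avg_add:
  assumes "sigma_finite_measure M" "f \<in> borel_measurable M" "g \<in> borel_measurable M" "0 < t"
  shows "rearr_avg M (\<lambda>x. f x + g x) t \<le> rearr_avg M f t + rearr_avg M g t"
  unfolding rearr_avg_def add_divide_distrib_ennreal[symmetric]
  by (intro divide_right_mono_ennreal integral_rearr_add assms)

lemma incseq_of_AE_incseq:
  fixes u :: "nat \<Rightarrow> 'a \<Rightarrow> real" and \<nu> :: "('a \<Rightarrow> real) \<Rightarrow> ennreal"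
  assumes mono: "\<And>f g. f \<in> borel_measurable M \<Longrightarrow> g \<in> borel_measurable M
      \<Longrightarrow> AE x in M. \<bar>f x\<bar> \<le> \<bar>g x\<bar> \<Longrightarrow> \<nu> f \<le> \<nu> g"
    and "\<And>n. u n \<in> borel_measurable M" "AE x in M. incseq (\<lambda>n. u n x)" "\<And>n. AE x in M. 0 \<le> u n x"
  shows "incseq (\<lambda>n. \<nu> (u n))"
proof (intro incseq_SucI mono assms(2))
  fix n show "AE x in M. \<bar>u n x\<bar> \<le> \<bar>u (Suc n) x\<bar>"
    using assms(3) assms(4)[of n] by eventually_elim (auto simp: incseq_Suc_iff intro: order.trans)
qed

lemma rearr_avg_Fatou:
  assumes [measurable]: "f \<in> borel_measurable M" "\<And>n. u n \<in> borel_measurable M"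
    and inc: "AE x in M. incseq (\<lambda>n. u n x) \<and> (\<lambda>n. u n x) \<longlonglongrightarrow> \<bar>f x\<bar>"
    and pos: "\<And>n. AE x in M. 0 \<le> u n x"
  shows "rearr_avg M f t \<le> (SUP n. rearr_avg M (u n) t)"
proof -
  have inc_rearr: "incseq (\<lambda>n. rearr M (u n) s)" for s
    using inc pos by (intro incseq_of_AE_incseq[where M = M] rearr_mono_AE) auto
  have "(\<integral>\<^sup>+s\<in>{0<..<t}. rearr M f s \<partial>lborel) \<le> (\<integral>\<^sup>+s. (SUP n. rearr M (u n) s * indicator {0<..<t} s) \<partial>lborel)"
    unfolding SUP_mult_right_ennreal[symmetric]
    by (intro nn_integral_mono mult_right_mono rearr_Fatou assms) simp
  also have "\<dots> = (SUP n. \<integral>\<^sup>+s\<in>{0<..<t}. rearr M (u n) s \<partial>lborel)"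
    using inc_rearr by (intro nn_integral_monotone_convergence_SUP_AE AE_I2 mult_right_mono)
      (auto simp: incseq_Suc_iff)
  finally show ?thesis
    unfolding rearr_avg_def SUP_divide_ennreal[symmetric] by (rule divide_right_mono_ennreal)
qed

section \<open>The Lorentz functional\<close>

text \<open>
  Haar measure \<open>dt / t\<close> of the multiplicative group of positive reals.
\<close>

definition haar :: "real measure" where
  "haar = density (restrict_space lborel {0<..}) (\<lambda>t. ennreal (1 / t))"

lemma space_haar [simp]: "space haar = {0<..}"
  by (simp add: haar_def space_restrict_space)

lemma measurable_haar [measurable (raw)]: "u \<in> borel_measurable borel \<Longrightarrow> u \<in> borel_measurable haar"
  by (simp add: haar_def measurable_restrict_space1)

lemma nn_integral_haar:
  assumes [measurable]: "u \<in> borel_measurable borel"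
  shows "(\<integral>\<^sup>+t. u t \<partial>haar) = (\<integral>\<^sup>+t\<in>{0<..}. u t * ennreal (1 / t) \<partial>lborel)"
  by (simp add: haar_def nn_integral_density nn_integral_restrict_space measurable_restrict_space1 mult_ac)

lemma AE_haar:
  assumes "AE t in haar. P t"
  shows "AE t in lborel. 0 < t \<longrightarrow> P t"
proof -
  have "(\<lambda>t. ennreal (1 / t)) \<in> borel_measurable (restrict_space lborel {0<..})"
    by (rule measurable_restrict_space1) measurable
  then have "AE t in restrict_space lborel {0<..}. 0 < ennreal (1 / t) \<longrightarrow> P t"
    using assms unfolding haar_def by (subst (asm) AE_density)
  then show ?thesis
    by (subst (asm) AE_restrict_space_iff) (auto elim: eventually_mono)
qed

lemma lorentz_functional_eq_Lr_norm:
  assumes [measurable]: "h \<in> borel_measurable borel"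
  shows "lorentz_functional p r h = Lr_norm haar r (\<lambda>t. ennreal (t powr enn2real (1 / p)) * h t)"
  by (simp add: lorentz_functional_def Lr_norm_def nn_integral_haar)

lemma lorentz_functional_mono:
  assumes "0 < r" and [measurable]: "h \<in> borel_measurable borel" "k \<in> borel_measurable borel"
    and "\<And>t. 0 < t \<Longrightarrow> h t \<le> k t"
  shows "lorentz_functional p r h \<le> lorentz_functional p r k"
  using assms by (auto simp: lorentz_functional_eq_Lr_norm intro!: Lr_norm_mono mult_left_mono)

lemma lorentz_functional_cmult:
  assumes "0 < r" and [measurable]: "h \<in> borel_measurable borel"
  shows "lorentz_functional p r (\<lambda>t. c * h t) = c * lorentz_functional p r h"
  using assms(1) by (simp add: lorentz_functional_eq_Lr_norm mult.left_commute[of _ c] Lr_norm_cmult)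

lemma lorentz_functional_SUP:
  assumes "0 < r" and [measurable]: "\<And>n::nat. h n \<in> borel_measurable borel"
    and "\<And>t. 0 < t \<Longrightarrow> incseq (\<lambda>n. h n t)"
  shows "lorentz_functional p r (\<lambda>t. SUP n. h n t) = (SUP n. lorentz_functional p r (h n))"
  by (simp add: lorentz_functional_eq_Lr_norm SUP_mult_left_ennreal,
      rule Lr_norm_SUP[OF assms(1)]) (use assms(3) in \<open>auto simp: incseq_def mult_left_mono\<close>)

lemma lorentz_functional_add:
  assumes "0 < r" and [measurable]: "h \<in> borel_measurable borel" "k \<in> borel_measurable borel"
  shows "lorentz_functional p r (\<lambda>t. h t + k t)
    \<le> ennreal (Lr_const r) * (lorentz_functional p r h + lorentz_functional p r k)"
proof -
  have "lorentz_functional p r (\<lambda>t. h t + k t)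
    = Lr_norm haar r (\<lambda>t. ennreal (t powr enn2real (1 / p)) * h t + ennreal (t powr enn2real (1 / p)) * k t)"
    by (simp add: lorentz_functional_eq_Lr_norm distrib_left)
  also have "\<dots> \<le> ennreal (Lr_const r) * (lorentz_functional p r h + lorentz_functional p r k)"
    unfolding lorentz_functional_eq_Lr_norm[OF assms(2)] lorentz_functional_eq_Lr_norm[OF assms(3)]
    by (rule Lr_norm_add[OF assms(1)]) measurable
  finally show ?thesis .
qed

lemma lorentz_functional_eq_0:
  assumes "0 < r" and [measurable]: "h \<in> borel_measurable borel" and "lorentz_functional p r h = 0"
  shows "AE t in lborel. 0 < t \<longrightarrow> h t = 0"
proof -
  have "AE t in haar. ennreal (t powr enn2real (1 / p)) * h t = 0"
    using assms by (intro Lr_norm_eq_0[OF assms(1)]) (simp_all add: lorentz_functional_eq_Lr_norm)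
  from AE_haar[OF this] show ?thesis by (auto elim!: eventually_mono)
qed

lemma antimono_AE_0_imp_0:
  fixes h :: "real \<Rightarrow> ennreal"
  assumes ae: "AE t in lborel. 0 < t \<longrightarrow> h t = 0" and anti: "\<And>s t. 0 < s \<Longrightarrow> s \<le> t \<Longrightarrow> h t \<le> h s"
    and t: "0 < t"
  shows "h t = 0"
proof (rule ccontr)
  assume "h t \<noteq> 0"
  then have "\<not> (0 < s \<longrightarrow> h s = 0)" if "s \<in> {0<..<t}" for s
    using anti[of s t] that by auto
  then have "AE s in lborel. s \<notin> {0<..<t}" using ae by (auto elim: eventually_mono)
  then have "emeasure lborel {0<..<t} = 0"
    by (subst (asm) AE_iff_measurable[of "{0<..<t}"]) auto
  then show False using t by simp
qed

text \<open>
  The substitution \<open>t = 2 s\<close> leaves \<open>dt / t\<close> invariant; only the factor \<open>t\<^bsup>1/p\<^esup>\<close> contributes.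
\<close>

lemma lorentz_functional_dilate:
  assumes r: "0 < r" and [measurable]: "h \<in> borel_measurable borel"
  shows "lorentz_functional p r (\<lambda>t. h (t / 2)) = ennreal (2 powr enn2real (1 / p)) * lorentz_functional p r h"
  using r
proof (cases rule: exponent_cases)
  case top
  let ?a = "enn2real (1 / p)"
  have img: "{0<..} = (\<lambda>t::real. 2 * t) ` {0<..}"
    by (auto simp: image_iff intro!: bexI[of _ "_ / 2"])
  have "(SUP t\<in>{0<..}. ennreal (t powr ?a) * h (t / 2)) = (SUP t\<in>{0<..}. ennreal ((2 * t) powr ?a) * h t)"
    by (subst img) (simp add: image_comp)
  also have "\<dots> = (SUP t\<in>{0<..}. ennreal (2 powr ?a) * (ennreal (t powr ?a) * h t))"
    by (rule SUP_cong) (auto simp: powr_mult ennreal_mult mult.assoc)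
  finally show ?thesis
    using top by (simp add: lorentz_functional_def SUP_mult_left_ennreal)
next
  case (finite s)
  let ?a = "enn2real (1 / p)"
  let ?F = "\<lambda>t. enn_powr (ennreal (t powr ?a) * h t) s * ennreal (1 / t) * indicator {0<..} t"
  let ?G = "\<lambda>t. enn_powr (ennreal (t powr ?a) * h (t / 2)) s * ennreal (1 / t) * indicator {0<..} t"
  have "(\<integral>\<^sup>+t. ?G t \<partial>lborel) = ennreal \<bar>2\<bar> * (\<integral>\<^sup>+t. ?G (0 + 2 * t) \<partial>lborel)"
    by (rule nn_integral_real_affine) simp_all
  also have "\<dots> = (\<integral>\<^sup>+t. ennreal 2 * ?G (2 * t) \<partial>lborel)"
    by (subst nn_integral_cmult) simp_all
  also have "\<dots> = (\<integral>\<^sup>+t. ennreal ((2 powr ?a) powr s) * ?F t \<partial>lborel)"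
  proof (rule nn_integral_cong)
    fix t :: real
    show "ennreal 2 * ?G (2 * t) = ennreal ((2 powr ?a) powr s) * ?F t"
    proof (cases "0 < t")
      case True
      have "ennreal ((2 * t) powr ?a) * h t = ennreal (2 powr ?a) * (ennreal (t powr ?a) * h t)"
        using True by (simp add: powr_mult ennreal_mult mult.assoc)
      then have E: "enn_powr (ennreal ((2 * t) powr ?a) * h t) s
         = ennreal ((2 powr ?a) powr s) * enn_powr (ennreal (t powr ?a) * h t) s"
        using finite by (simp add: enn_powr_mult enn_powr_ennreal)
      have D: "ennreal 2 * ennreal (1 / (2 * t)) = ennreal (1 / t)"
        using True by (subst ennreal_mult[symmetric]) simp_all
      have "ennreal 2 * ?G (2 * t)
         = enn_powr (ennreal ((2 * t) powr ?a) * h t) s * (ennreal 2 * ennreal (1 / (2 * t)))"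
        using True by (simp add: mult.left_commute)
      also have "\<dots> = ennreal ((2 powr ?a) powr s) * ?F t"
        unfolding E D using True by (simp add: mult.assoc)
      finally show ?thesis .
    qed simp
  qed
  also have "\<dots> = ennreal ((2 powr ?a) powr s) * (\<integral>\<^sup>+t. ?F t \<partial>lborel)"
    by (rule nn_integral_cmult) simp
  finally show ?thesis
    using finite by (simp add: lorentz_functional_def enn_powr_mult enn_powr_ennreal powr_powr)
qed

section \<open>Hardy's lemma and the triangle inequality for \<open>1 \<le> r \<le> p\<close>\<close>

text \<open>
  An initial segment of the half line is empty, the whole half line, or agrees with some
  interval \<open>(0, b)\<close> except possibly at \<open>b\<close>.
\<close>

lemma initial_segment_integral_le:
  fixes \<eta> \<psi> :: "real \<Rightarrow> ennreal"
  assumes [measurable]: "\<eta> \<in> borel_measurable borel" "\<psi> \<in> borel_measurable borel"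
    and le: "\<And>t. 0 < t \<Longrightarrow> (\<integral>\<^sup>+s\<in>{0<..<t}. \<eta> s \<partial>lborel) \<le> (\<integral>\<^sup>+s\<in>{0<..<t}. \<psi> s \<partial>lborel)"
    and S: "S \<subseteq> {0<..}" and down: "\<And>s u. s \<in> S \<Longrightarrow> 0 < u \<Longrightarrow> u \<le> s \<Longrightarrow> u \<in> S"
  shows "(\<integral>\<^sup>+s\<in>S. \<eta> s \<partial>lborel) \<le> (\<integral>\<^sup>+s\<in>S. \<psi> s \<partial>lborel)"
proof (cases "S = {}")
  case False
  then obtain s0 where s0: "s0 \<in> S" by auto
  show ?thesis
  proof (cases "bdd_above S")
    case True
    define b where "b = Sup S"
    have b: "s \<le> b" if "s \<in> S" for s unfolding b_def using True that by (rule cSup_upper[rotated])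
    have "0 < b" using b[OF s0] S s0 by force
    have below: "s \<in> S" if "0 < s" "s < b" for s
    proof -
      obtain u where "u \<in> S" "s < u" using \<open>s < b\<close> s0 True less_cSup_iff[of S s] unfolding b_def by blast
      then show ?thesis using down that by auto
    qed
    have "(\<integral>\<^sup>+s\<in>S. \<eta> s \<partial>lborel) \<le> (\<integral>\<^sup>+s\<in>{0<..<b}. \<eta> s \<partial>lborel)"
    proof (rule nn_integral_mono_AE)
      show "AE s in lborel. \<eta> s * indicator S s \<le> \<eta> s * indicator {0<..<b} s"
        using AE_lborel_singleton[of b] by eventually_elim (use b S in \<open>force simp: indicator_def\<close>)
    qed
    also have "\<dots> \<le> (\<integral>\<^sup>+s\<in>{0<..<b}. \<psi> s \<partial>lborel)" by (rule le) fact
    also have "\<dots> \<le> (\<integral>\<^sup>+s\<in>S. \<psi> s \<partial>lborel)"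
      by (rule nn_integral_mono) (use below in \<open>auto simp: indicator_def\<close>)
    finally show ?thesis .
  next
    case False
    have "S = {0<..}"
    proof (intro equalityI S subsetI)
      fix x :: real assume "x \<in> {0<..}"
      moreover obtain u where "u \<in> S" "x \<le> u"
        using False unfolding bdd_above_def by (metis nle_le)
      ultimately show "x \<in> S" using down by auto
    qed
    have lim: "(\<integral>\<^sup>+s\<in>{0<..}. w s \<partial>lborel) = (SUP n. \<integral>\<^sup>+s\<in>{0<..<real n}. w s \<partial>lborel)"
      if [measurable]: "w \<in> borel_measurable borel" for w :: "real \<Rightarrow> ennreal"
    proof -
      have "w s * indicator {0<..} s = (SUP n. w s * indicator {0<..<real n} s)" for s
      proof (rule antisym)
        obtain n where "s < real n" using reals_Archimedean2 by blast
        then show "w s * indicator {0<..} s \<le> (SUP n. w s * indicator {0<..<real n} s)"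
          by (intro SUP_upper2[of n]) (auto simp: indicator_def)
      qed (intro SUP_least, auto simp: indicator_def)
      then show ?thesis
        by (simp, intro nn_integral_monotone_convergence_SUP_AE AE_I2) (auto simp: indicator_def)
    qed
    show ?thesis unfolding \<open>S = {0<..}\<close>
    proof (subst (1 2) lim)
      show "(SUP n. \<integral>\<^sup>+s\<in>{0<..<real n}. \<eta> s \<partial>lborel) \<le> (SUP n. \<integral>\<^sup>+s\<in>{0<..<real n}. \<psi> s \<partial>lborel)"
      proof (rule SUP_mono, rule bexI)
        fix n show "(\<integral>\<^sup>+s\<in>{0<..<real n}. \<eta> s \<partial>lborel) \<le> (\<integral>\<^sup>+s\<in>{0<..<real n}. \<psi> s \<partial>lborel)"
          by (cases "n = 0") (auto intro: le)
      qed simp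
    qed simp_all
  qed
qed simp

text \<open>
  An antitone weight is a superposition of indicators of its superlevel sets, which are initial
  segments of the half line.
\<close>

lemma Hardy_lemma:
  fixes \<eta> \<psi> h :: "real \<Rightarrow> ennreal"
  assumes [measurable]: "\<eta> \<in> borel_measurable borel" "\<psi> \<in> borel_measurable borel" "h \<in> borel_measurable borel"
    and le: "\<And>t. 0 < t \<Longrightarrow> (\<integral>\<^sup>+s\<in>{0<..<t}. \<eta> s \<partial>lborel) \<le> (\<integral>\<^sup>+s\<in>{0<..<t}. \<psi> s \<partial>lborel)"
    and anti: "\<And>s t. 0 < s \<Longrightarrow> s \<le> t \<Longrightarrow> h t \<le> h s"
  shows "(\<integral>\<^sup>+t\<in>{0<..}. \<eta> t * h t \<partial>lborel) \<le> (\<integral>\<^sup>+t\<in>{0<..}. \<psi> t * h t \<partial>lborel)"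
proof -
  let ?S = "\<lambda>l. {t. 0 < t \<and> 0 < l \<and> ennreal l < h t}"
  have layers: "(\<integral>\<^sup>+t\<in>{0<..}. w t * h t \<partial>lborel) = (\<integral>\<^sup>+l. (\<integral>\<^sup>+t\<in>?S l. w t \<partial>lborel) \<partial>lborel)"
    if [measurable]: "w \<in> borel_measurable borel" for w :: "real \<Rightarrow> ennreal"
  proof -
    have "(\<integral>\<^sup>+t\<in>{0<..}. w t * h t \<partial>lborel)
      = (\<integral>\<^sup>+t. (\<integral>\<^sup>+l. w t * (if 0 < t \<and> 0 < l \<and> ennreal l < h t then 1 else 0) \<partial>lborel) \<partial>lborel)"
    proof (rule nn_integral_cong)
      fix t :: real
      have "w t * h t * indicator {0<..} t
        = (\<integral>\<^sup>+l. w t * indicator {0<..} t * indicator {l. 0 < l \<and> ennreal l < h t} l \<partial>lborel)"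
        using emeasure_layers[of 0 "h t"] by (simp add: nn_integral_cmult mult_ac)
      also have "\<dots> = (\<integral>\<^sup>+l. w t * (if 0 < t \<and> 0 < l \<and> ennreal l < h t then 1 else 0) \<partial>lborel)"
        by (rule nn_integral_cong) auto
      finally show "w t * h t * indicator {0<..} t = \<dots>" .
    qed
    also have "\<dots> = (\<integral>\<^sup>+l. (\<integral>\<^sup>+t. w t * (if 0 < t \<and> 0 < l \<and> ennreal l < h t then 1 else 0) \<partial>lborel) \<partial>lborel)"
      by (rule lborel_pair.Fubini'[symmetric]) measurable
    also have "\<dots> = (\<integral>\<^sup>+l. (\<integral>\<^sup>+t\<in>?S l. w t \<partial>lborel) \<partial>lborel)"
      by (intro nn_integral_cong) auto
    finally show ?thesis .
  qed
  have "(\<integral>\<^sup>+t\<in>?S l. \<eta> t \<partial>lborel) \<le> (\<integral>\<^sup>+t\<in>?S l. \<psi> t \<partial>lborel)" for l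
    by (rule initial_segment_integral_le[OF _ _ le]) (auto intro: less_le_trans anti)
  then show ?thesis by (simp add: layers nn_integral_mono)
qed

lemma Young_powr:
  fixes x y :: real
  assumes "0 \<le> x" "0 \<le> y" "1 < s"
  shows "x * y powr (s - 1) \<le> 1 / s * x powr s + (1 - 1 / s) * y powr s"
proof -
  have "(y powr (s - 1)) powr (s / (s - 1)) = y powr s"
    using assms by (simp add: powr_powr)
  then show ?thesis
    using Youngs_inequality[of s "s / (s - 1)" x "y powr (s - 1)"] assms
    by (simp add: field_simps)
qed

lemma enn_Young:
  assumes "1 < s"
  shows "x * enn_powr y (s - 1) \<le> ennreal (1 / s) * enn_powr x s + ennreal (1 - 1 / s) * enn_powr y s"
proof (cases x; cases y)
  fix a b assume "x = ennreal a" "y = ennreal b" "0 \<le> a" "0 \<le> b"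
  then show ?thesis
    using Young_powr[of a b s] assms
    by (simp add: enn_powr_ennreal ennreal_leI flip: ennreal_plus ennreal_mult)
qed (use assms in \<open>auto simp: ennreal_mult_top\<close>)

text \<open>
  Write \<open>\<eta>\<^sup>s = \<eta> \<cdot> \<eta>\<^bsup>s - 1\<^esup>\<close>. The weight \<open>w \<eta>\<^bsup>s - 1\<^esup>\<close> is antitone, so by Hardy's lemma one factor
  \<open>\<eta>\<close> may be replaced by \<open>\<psi>\<close>. Young's inequality then bounds the integral by a convex
  combination of the two sides, and the finite left-hand side is absorbed.
\<close>

lemma weighted_power_integral_le:
  fixes \<eta> \<psi> w :: "real \<Rightarrow> ennreal"
  assumes [measurable]: "\<eta> \<in> borel_measurable borel" "\<psi> \<in> borel_measurable borel" "w \<in> borel_measurable borel"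
    and le: "\<And>t. 0 < t \<Longrightarrow> (\<integral>\<^sup>+s\<in>{0<..<t}. \<eta> s \<partial>lborel) \<le> (\<integral>\<^sup>+s\<in>{0<..<t}. \<psi> s \<partial>lborel)"
    and anti: "\<And>s t. 0 < s \<Longrightarrow> s \<le> t \<Longrightarrow> \<eta> t \<le> \<eta> s" "\<And>s t. 0 < s \<Longrightarrow> s \<le> t \<Longrightarrow> w t \<le> w s"
    and s: "1 \<le> s" and fin: "(\<integral>\<^sup>+t\<in>{0<..}. enn_powr (\<eta> t) s * w t \<partial>lborel) < top"
  shows "(\<integral>\<^sup>+t\<in>{0<..}. enn_powr (\<eta> t) s * w t \<partial>lborel) \<le> (\<integral>\<^sup>+t\<in>{0<..}. enn_powr (\<psi> t) s * w t \<partial>lborel)"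
    (is "?A \<le> ?B")
proof (cases "s = 1")
  case True
  \<comment> \<open>Here \<open>\<eta>\<^bsup>s - 1\<^esup>\<close> would be \<open>0\<close> at zeros of \<open>\<eta>\<close> and \<open>\<infinity>\<close> where \<open>\<eta> = \<infinity>\<close>, so \<open>w\<close> itself serves as weight.\<close>
  then show ?thesis using Hardy_lemma[OF assms(1,2,3) le anti(2)] by simp
next
  case False
  then have s: "1 < s" using s by simp
  let ?h = "\<lambda>t. enn_powr (\<eta> t) (s - 1) * w t"
  have split: "enn_powr x s = x * enn_powr x (s - 1)" for x
    using s by (cases x) (auto simp: enn_powr_ennreal powr_diff ennreal_eq_0_iff simp flip: ennreal_mult)
  have "?A = (\<integral>\<^sup>+t\<in>{0<..}. \<eta> t * ?h t \<partial>lborel)" by (simp add: split mult.assoc)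
  also have "\<dots> \<le> (\<integral>\<^sup>+t\<in>{0<..}. \<psi> t * ?h t \<partial>lborel)"
    using s anti by (intro Hardy_lemma le) (auto intro!: mult_mono enn_powr_mono)
  also have "\<dots> \<le> (\<integral>\<^sup>+t\<in>{0<..}. (ennreal (1 / s) * enn_powr (\<psi> t) s + ennreal (1 - 1 / s) * enn_powr (\<eta> t) s) * w t \<partial>lborel)"
    unfolding mult.assoc[symmetric] using s by (intro nn_integral_mono mult_right_mono enn_Young) simp_all
  also have "\<dots> = (\<integral>\<^sup>+t. ennreal (1 / s) * (enn_powr (\<psi> t) s * w t * indicator {0<..} t)
      + ennreal (1 - 1 / s) * (enn_powr (\<eta> t) s * w t * indicator {0<..} t) \<partial>lborel)"
    by (simp add: distrib_right mult.assoc)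
  also have "\<dots> = ennreal (1 / s) * ?B + ennreal (1 - 1 / s) * ?A"
    by (subst nn_integral_add) (simp_all add: nn_integral_cmult)
  finally have main: "?A \<le> ennreal (1 / s) * ?B + ennreal (1 - 1 / s) * ?A" .
  show ?thesis
  proof (cases ?B)
    case (real b)
    obtain a where a: "?A = ennreal a" "0 \<le> a" using fin by (cases ?A) auto
    have "ennreal a \<le> ennreal (1 / s * b + (1 - 1 / s) * a)"
    proof -
      have "0 \<le> 1 / s" "0 \<le> 1 - 1 / s" using s by simp_all
      then have "ennreal (1 / s) * ennreal b + ennreal (1 - 1 / s) * ennreal a
         = ennreal (1 / s * b + (1 - 1 / s) * a)"
        using real(1) a(2) by (metis ennreal_mult ennreal_plus mult_nonneg_nonneg)
      then show ?thesis using main unfolding a(1) real(2) by simp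
    qed
    then have "a \<le> 1 / s * b + (1 - 1 / s) * a"
      using s a real by (subst (asm) ennreal_le_iff) simp_all
    then have "a \<le> b" using s by (simp add: field_simps)
    then show ?thesis using a real by (simp add: ennreal_leI)
  qed simp
qed

lemma enn2real_inverse: "p \<noteq> 0 \<Longrightarrow> enn2real (1 / p) = 1 / enn2real p"
  by (cases p) (auto simp: divide_ennreal simp flip: ennreal_1)

text \<open>For \<open>r \<le> p\<close> the weight \<open>t\<^bsup>r/p - 1\<^esup>\<close> is antitone, so Hardy's lemma applies.\<close>

lemma lorentz_functional_le_of_integrals_le:
  fixes \<eta> \<psi> :: "real \<Rightarrow> ennreal"
  assumes [measurable]: "\<eta> \<in> borel_measurable borel" "\<psi> \<in> borel_measurable borel"
    and le: "\<And>t. 0 < t \<Longrightarrow> (\<integral>\<^sup>+s\<in>{0<..<t}. \<eta> s \<partial>lborel) \<le> (\<integral>\<^sup>+s\<in>{0<..<t}. \<psi> s \<partial>lborel)"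
    and anti: "\<And>s t. 0 < s \<Longrightarrow> s \<le> t \<Longrightarrow> \<eta> t \<le> \<eta> s"
    and rp: "1 \<le> r" "r \<le> p" "p < \<infinity>"
    and fin: "lorentz_functional p r \<eta> < top"
  shows "lorentz_functional p r \<eta> \<le> lorentz_functional p r \<psi>"
proof -
  obtain P where P: "p = ennreal P" "0 \<le> P" using rp by (cases p) auto
  obtain s where s: "r = ennreal s" "0 \<le> s" using rp by (cases r) (auto simp: top_unique)
  have sP: "1 \<le> s" "s \<le> P" using rp P s by (auto simp: ennreal_le_iff simp flip: ennreal_1)
  have a: "enn2real (1 / p) = 1 / P" using P sP by (subst enn2real_inverse) auto
  let ?w = "\<lambda>t. ennreal (t powr (s / P - 1))"
  have eq: "lorentz_functional p r h = enn_powr (\<integral>\<^sup>+t\<in>{0<..}. enn_powr (h t) s * ?w t \<partial>lborel) (1 / s)" for h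
  proof -
    have "enn_powr (ennreal (t powr (1 / P)) * h t) s * ennreal (1 / t) * indicator {0<..} t
       = enn_powr (h t) s * ?w t * indicator {0<..} t" for t
    proof (cases "0 < t")
      case True
      then have "ennreal (t powr (s / P)) * ennreal (1 / t) = ?w t"
        by (simp add: powr_diff flip: ennreal_mult)
      moreover have "enn_powr (ennreal (t powr (1 / P)) * h t) s = ennreal (t powr (s / P)) * enn_powr (h t) s"
        using sP by (simp add: enn_powr_mult enn_powr_ennreal powr_powr)
      ultimately show ?thesis by (metis mult.commute mult.left_commute)
    qed simp
    then show ?thesis using a s by (simp add: lorentz_functional_def)
  qed
  have wanti: "?w t \<le> ?w u" if "0 < u" "u \<le> t" for u t
    using that sP by (intro ennreal_leI powr_mono2') (auto simp: field_simps)
  have "(\<integral>\<^sup>+t\<in>{0<..}. enn_powr (\<eta> t) s * ?w t \<partial>lborel) < top"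
    using fin sP unfolding eq by (simp add: enn_powr_less_top_iff)
  then have "(\<integral>\<^sup>+t\<in>{0<..}. enn_powr (\<eta> t) s * ?w t \<partial>lborel) \<le> (\<integral>\<^sup>+t\<in>{0<..}. enn_powr (\<psi> t) s * ?w t \<partial>lborel)"
    using sP by (intro weighted_power_integral_le le anti wanti) auto
  then show ?thesis unfolding eq using sP by (intro enn_powr_mono) auto
qed

section \<open>Extended quasi-norms on measurable functions\<close>

text \<open>
  Values in \<open>[0, \<infinity>]\<close> and quantification over all measurable functions avoid finiteness side
  conditions. The last axiom is one half of the Fatou property; monotonicity supplies the other.
\<close>

locale function_quasi_norm =
  fixes M :: "'a measure" and C :: real and \<nu> :: "('a \<Rightarrow> real) \<Rightarrow> ennreal"
  assumes C_ge_1: "1 \<le> C"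
    and mono: "\<And>f g. f \<in> borel_measurable M \<Longrightarrow> g \<in> borel_measurable M \<Longrightarrow>
        AE x in M. \<bar>f x\<bar> \<le> \<bar>g x\<bar> \<Longrightarrow> \<nu> f \<le> \<nu> g"
    and cmult: "\<And>c f. f \<in> borel_measurable M \<Longrightarrow> \<nu> (\<lambda>x. c * f x) = ennreal \<bar>c\<bar> * \<nu> f"
    and add: "\<And>f g. f \<in> borel_measurable M \<Longrightarrow> g \<in> borel_measurable M \<Longrightarrow>
        \<nu> (\<lambda>x. f x + g x) \<le> ennreal C * (\<nu> f + \<nu> g)"
    and definite: "\<And>f. f \<in> borel_measurable M \<Longrightarrow> \<nu> f = 0 \<Longrightarrow> AE x in M. f x = 0"
    and Fatou: "\<And>f u. f \<in> borel_measurable M \<Longrightarrow> (\<And>n::nat. u n \<in> borel_measurable M) \<Longrightarrow>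
        AE x in M. incseq (\<lambda>n. u n x) \<and> (\<lambda>n. u n x) \<longlonglongrightarrow> \<bar>f x\<bar> \<Longrightarrow>
        (\<And>n. AE x in M. 0 \<le> u n x) \<Longrightarrow> \<nu> f \<le> (SUP n. \<nu> (u n))"
begin

lemma vanishing:
  assumes [measurable]: "f \<in> borel_measurable M" and "AE x in M. f x = 0"
  shows "\<nu> f = 0"
proof -
  have "\<nu> f \<le> \<nu> (\<lambda>x. 0 * f x)"
    using assms(2) by (intro mono) auto
  then show ?thesis unfolding cmult[OF assms(1)] by simp
qed

lemma eq_0_iff: "f \<in> borel_measurable M \<Longrightarrow> \<nu> f = 0 \<longleftrightarrow> (AE x in M. f x = 0)"
  using definite vanishing by blast

lemma finite_add:
  assumes "f \<in> borel_measurable M" "g \<in> borel_measurable M" "\<nu> f < top" "\<nu> g < top"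
  shows "\<nu> (\<lambda>x. f x + g x) < top"
  by (rule le_less_trans[OF add]) (use assms in \<open>auto simp: ennreal_mult_less_top\<close>)

lemma finite_diff:
  assumes "f \<in> borel_measurable M" "g \<in> borel_measurable M" "\<nu> f < top" "\<nu> g < top"
  shows "\<nu> (\<lambda>x. f x - g x) < top"
  using finite_add[of f "\<lambda>x. - 1 * g x"] cmult[of g "-1"] assms by simp

lemma real_add:
  assumes "f \<in> borel_measurable M" "g \<in> borel_measurable M" "\<nu> f < top" "\<nu> g < top"
  shows "enn2real (\<nu> (\<lambda>x. f x + g x)) \<le> C * (enn2real (\<nu> f) + enn2real (\<nu> g))"
proof -
  have "enn2real (\<nu> (\<lambda>x. f x + g x)) \<le> enn2real (ennreal C * (\<nu> f + \<nu> g))"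
    using add[OF assms(1,2)] assms(3,4) by (intro enn2real_mono) (auto simp: ennreal_mult_less_top)
  also have "\<dots> = C * (enn2real (\<nu> f) + enn2real (\<nu> g))"
    using C_ge_1 assms(3,4) by (simp add: enn2real_mult enn2real_plus)
  finally show ?thesis .
qed

text \<open>
  On the set \<open>E\<close> where the sequence is unbounded, its truncations at height \<open>c\<close> increase to
  \<open>c \<chi>\<^sub>E\<close>. Hence \<open>c \<nu>(\<chi>\<^sub>E) \<le> K\<close> for every \<open>c\<close>, so \<open>\<nu>(\<chi>\<^sub>E) = 0\<close>.
\<close>

lemma AE_bounded:
  assumes [measurable]: "\<And>n::nat. G n \<in> borel_measurable M"
    and G: "\<And>n x. 0 \<le> G n x" "\<And>x. incseq (\<lambda>n. G n x)"
    and K: "\<And>n. \<nu> (G n) \<le> ennreal K"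
  shows "AE x in M. \<exists>B. \<forall>n. G n x \<le> B"
proof -
  let ?bdd = "\<lambda>x. \<exists>b::nat. \<forall>n. G n x \<le> real b"
  define E where "E = {x \<in> space M. \<not> ?bdd x}"
  have [measurable]: "E \<in> sets M" unfolding E_def by measurable
  have bound: "ennreal c * \<nu> (indicator E) \<le> ennreal K" if c: "0 < c" for c
  proof -
    let ?v = "\<lambda>n x. min (G n x) c * indicator E x"
    have "ennreal c * \<nu> (indicator E) = \<nu> (\<lambda>x. c * indicator E x)"
      using c cmult[of "indicator E" c] by simp
    also have "\<dots> \<le> (SUP n. \<nu> (?v n))"
    proof (rule Fatou)
      show "AE x in M. incseq (\<lambda>n. ?v n x) \<and> (\<lambda>n. ?v n x) \<longlonglongrightarrow> \<bar>c * indicator E x\<bar>"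
      proof (intro AE_I2 conjI)
        fix x
        have "min (G m x) c \<le> min (G n x) c" if "m \<le> n" for m n
          using G(2)[of x] that by (intro min.mono) (auto simp: incseq_def)
        then show "incseq (\<lambda>n. ?v n x)" by (auto simp: incseq_def indicator_def)
        show "(\<lambda>n. ?v n x) \<longlonglongrightarrow> \<bar>c * indicator E x\<bar>"
        proof (cases "x \<in> E")
          case True
          obtain b :: nat where b: "c \<le> real b" using real_arch_simple by blast
          obtain n0 where "real b < G n0 x" using True unfolding E_def by (auto simp: not_le)
          then have "c \<le> G n x" if "n0 \<le> n" for n
            using monoD[OF G(2)[of x] that] b by linarith
          then have "eventually (\<lambda>n. ?v n x = \<bar>c * indicator E x\<bar>) sequentially"
            using True c by (auto simp: eventually_sequentially intro!: exI[of _ n0])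
          then show ?thesis by (rule tendsto_eventually)
        qed simp
      qed
    qed (use G c in auto)
    also have "\<dots> \<le> ennreal K"
    proof (rule SUP_least)
      fix n
      have "\<nu> (?v n) \<le> \<nu> (G n)" using G c by (intro mono) (auto simp: indicator_def)
      then show "\<nu> (?v n) \<le> ennreal K" using K order.trans by blast
    qed
    finally show ?thesis .
  qed
  have "\<nu> (indicator E) = 0"
  proof (rule ccontr)
    assume "\<nu> (indicator E) \<noteq> 0"
    moreover have "\<nu> (indicator E) < top" using bound[of 1] by (auto simp: le_less_trans)
    ultimately obtain e where e: "\<nu> (indicator E) = ennreal e" "0 < e"
      by (cases "\<nu> (indicator E)") (auto simp: less_le)
    have "ennreal ((\<bar>K\<bar> + 1) / e * e) \<le> ennreal K"
      using bound[of "(\<bar>K\<bar> + 1) / e"] e by (simp add: ennreal_mult[symmetric])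
    then show False using e by (cases "0 \<le> K") (auto simp: ennreal_neg)
  qed
  then have "AE x in M. indicator E x = (0::real)" by (intro definite) auto
  then show ?thesis
    using AE_space by eventually_elim (auto simp: E_def indicator_def split: if_splits)
qed

text \<open>
  Peeling off the summands one by one costs a factor \<open>C\<close> each time, which the ratio \<open>1 / (2 C)\<close>
  absorbs while still leaving a convergent geometric series.
\<close>

lemma sum_le_geometric:
  assumes [measurable]: "\<And>j::nat. g j \<in> borel_measurable M"
    and g: "\<And>j. \<nu> (g j) \<le> ennreal ((1 / (2 * C)) ^ j)"
  shows "\<nu> (\<lambda>x. \<Sum>j<J. g (k + j) x) \<le> ennreal (2 * C * (1 / (2 * C)) ^ k)"
proof (induction J arbitrary: k)
  case 0
  show ?case using vanishing[of "\<lambda>x. 0"] by simp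
next
  case (Suc J)
  have "\<nu> (\<lambda>x. \<Sum>j<Suc J. g (k + j) x) = \<nu> (\<lambda>x. g k x + (\<Sum>j<J. g (Suc k + j) x))"
    by (simp only: sum.lessThan_Suc_shift) simp
  also have "\<dots> \<le> ennreal C * (\<nu> (g k) + \<nu> (\<lambda>x. \<Sum>j<J. g (Suc k + j) x))"
    by (rule add) measurable
  also have "\<dots> \<le> ennreal C * (ennreal ((1 / (2 * C)) ^ k) + ennreal (2 * C * (1 / (2 * C)) ^ Suc k))"
    by (intro mult_left_mono add_mono g Suc.IH) simp
  also have "\<dots> = ennreal (C * ((1 / (2 * C)) ^ k + 2 * C * (1 / (2 * C)) ^ Suc k))"
    using C_ge_1 by (subst ennreal_plus[symmetric]; simp add: ennreal_mult)
  also have "C * ((1 / (2 * C)) ^ k + 2 * C * (1 / (2 * C)) ^ Suc k) = 2 * C * (1 / (2 * C)) ^ k"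
    using C_ge_1 by (simp add: field_simps)
  finally show ?case .
qed

text \<open>
  A subsequence \<open>v\<close> with geometrically small increments converges almost everywhere, because
  the sums of the absolute increments have bounded quasi-norms and hence are almost everywhere
  bounded. The Fatou property turns the bound on the tails of these sums into convergence of
  \<open>v\<close> in quasi-norm.
\<close>

lemma complete:
  fixes u :: "nat \<Rightarrow> 'a \<Rightarrow> real"
  assumes [measurable]: "\<And>n. u n \<in> borel_measurable M" and fin: "\<And>n. \<nu> (u n) < top"
    and cauchy: "\<And>\<epsilon>. 0 < \<epsilon> \<Longrightarrow> \<exists>n0. \<forall>m\<ge>n0. \<forall>n\<ge>n0. enn2real (\<nu> (\<lambda>x. u m x - u n x)) < \<epsilon>"
  shows "\<exists>f \<in> borel_measurable M. \<nu> f < top \<and> (\<lambda>n. enn2real (\<nu> (\<lambda>x. u n x - f x))) \<longlonglongrightarrow> 0"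
proof -
  define \<delta> where "\<delta> j = (1 / (2 * C)) ^ j" for j
  have \<delta>_pos: "0 < \<delta> j" for j using C_ge_1 by (simp add: \<delta>_def)
  have "\<forall>j. \<exists>n0. \<forall>m\<ge>n0. \<forall>n\<ge>n0. enn2real (\<nu> (\<lambda>x. u m x - u n x)) < \<delta> j"
    using cauchy[OF \<delta>_pos] by blast
  then obtain K where K: "\<And>j m n. K j \<le> m \<Longrightarrow> K j \<le> n \<Longrightarrow> enn2real (\<nu> (\<lambda>x. u m x - u n x)) < \<delta> j"
    by metis
  \<comment> \<open>Partial sums turn the indices \<open>K j\<close> into an increasing sequence that dominates them.\<close>
  define ix where "ix j = (\<Sum>i\<le>j. K i)" for j
  have ix: "K j \<le> ix j" "ix j \<le> ix (Suc j)" for j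
    by (auto simp: ix_def intro: member_le_sum)
  have real_fin: "ennreal (enn2real (\<nu> (\<lambda>x. u m x - u n x))) = \<nu> (\<lambda>x. u m x - u n x)" for m n
    using finite_diff[of "u m" "u n"] fin by simp
  define v where "v j = u (ix j)" for j
  have [measurable]: "v j \<in> borel_measurable M" for j by (simp add: v_def)
  define g where "g j x = \<bar>v (Suc j) x - v j x\<bar>" for j x
  have [measurable]: "g j \<in> borel_measurable M" for j unfolding g_def by measurable
  have "\<nu> (g j) \<le> ennreal (\<delta> j)" for j
  proof -
    have "\<nu> (g j) \<le> \<nu> (\<lambda>x. v (Suc j) x - v j x)" by (intro mono) (auto simp: g_def)
    also have "\<dots> \<le> ennreal (\<delta> j)"
      using K[of j "ix (Suc j)" "ix j"] ix[of j] real_fin[of "ix (Suc j)" "ix j"]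
      by (metis ennreal_leI le_trans less_imp_le v_def)
    finally show ?thesis .
  qed
  then have tail: "\<nu> (\<lambda>x. \<Sum>j<J. g (k + j) x) \<le> ennreal (2 * C * \<delta> k)" for J k
    unfolding \<delta>_def by (intro sum_le_geometric) simp_all
  have inc: "incseq (\<lambda>J. \<Sum>j<J. g (k + j) x)" for k x
    by (intro incseq_SucI) (simp add: g_def)
  have "AE x in M. \<exists>B. \<forall>J. (\<Sum>j<J. g (0 + j) x) \<le> B"
    by (rule AE_bounded[OF _ _ inc tail]) (auto simp: g_def intro: sum_nonneg)
  then have summ: "AE x in M. summable (\<lambda>j. g j x)"
  proof eventually_elim
    case (elim x)
    then obtain B where "\<And>J. (\<Sum>j<J. g j x) \<le> B" by auto
    then have "(\<Sum>j\<le>J. g j x) \<le> B" for J by (metis lessThan_Suc_atMost)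
    moreover have "0 \<le> g j x" for j by (simp add: g_def)
    ultimately show ?case by (rule bounded_imp_summable[rotated])
  qed
  \<comment> \<open>Where \<open>v\<close> diverges the value of \<open>lim\<close> is arbitrary; this happens on a null set only.\<close>
  define f where "f x = lim (\<lambda>j. v j x)" for x
  have [measurable]: "f \<in> borel_measurable M" unfolding f_def by measurable
  define H where "H k x = (\<Sum>j. g (k + j) x)" for k x
  have [measurable]: "H k \<in> borel_measurable M" for k unfolding H_def by measurable
  have summ': "AE x in M. \<forall>k. summable (\<lambda>j. g (k + j) x)"
    using summ 
  proof eventually_elim
    case (elim x)
    show ?case using summable_ignore_initial_segment[OF elim] by (simp add: add.commute)
  qed
  have f_close: "AE x in M. \<forall>k. \<bar>v k x - f x\<bar> \<le> \<bar>H k x\<bar>"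
    using summ summ'
  proof eventually_elim
    case (elim x)
    have "summable (\<lambda>j. v (Suc j) x - v j x)"
      using elim(1) unfolding g_def by (rule summable_rabs_cancel)
    from summable_LIMSEQ[OF this] have "(\<lambda>J. v J x - v 0 x) \<longlonglongrightarrow> (\<Sum>j. v (Suc j) x - v j x)"
      unfolding sum_lessThan_telescope[of "\<lambda>j. v j x"] .
    from tendsto_add[OF this tendsto_const[of "v 0 x"]] have "convergent (\<lambda>J. v J x)"
      by (simp only: diff_add_cancel) (rule convergentI)
    then have lim: "(\<lambda>J. v J x) \<longlonglongrightarrow> f x" unfolding f_def by (rule convergent_LIMSEQ_iff[THEN iffD1])
    show ?case
    proof
      fix k
      have "\<bar>v k x - v (k + J) x\<bar> \<le> H k x" for J
      proof -
        have "\<bar>v k x - v (k + J) x\<bar> = \<bar>\<Sum>j<J. v (Suc (k + j)) x - v (k + j) x\<bar>"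
          using sum_lessThan_telescope[of "\<lambda>j. v (k + j) x" J] by (simp add: abs_minus_commute)
        also have "\<dots> \<le> (\<Sum>j<J. g (k + j) x)" unfolding g_def by (rule sum_abs)
        also have "\<dots> \<le> H k x" unfolding H_def
          using elim(2) by (intro sum_le_suminf) (auto simp: g_def)
        finally show ?thesis .
      qed
      moreover have ptw: "(\<lambda>J. \<bar>v k x - v (k + J) x\<bar>) \<longlonglongrightarrow> \<bar>v k x - f x\<bar>"
        using LIMSEQ_ignore_initial_segment[OF lim, of k]
        by (intro tendsto_intros) (simp only: add.commute)
      ultimately have "\<bar>v k x - f x\<bar> \<le> H k x" using LIMSEQ_le_const2 by blast
      then show "\<bar>v k x - f x\<bar> \<le> \<bar>H k x\<bar>" by simp
    qed
  qed
  have close: "\<nu> (\<lambda>x. v k x - f x) \<le> ennreal (2 * C * \<delta> k)" for k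
  proof -
    have "\<nu> (\<lambda>x. v k x - f x) \<le> \<nu> (H k)" using f_close by (intro mono) (auto elim: eventually_mono)
    also have "\<dots> \<le> (SUP J. \<nu> (\<lambda>x. \<Sum>j<J. g (k + j) x))"
    proof (rule Fatou)
      show "AE x in M. incseq (\<lambda>J. \<Sum>j<J. g (k + j) x) \<and> (\<lambda>J. \<Sum>j<J. g (k + j) x) \<longlonglongrightarrow> \<bar>H k x\<bar>"
        using summ'
      proof eventually_elim
        case (elim x)
        then have "(\<lambda>J. \<Sum>j<J. g (k + j) x) \<longlonglongrightarrow> H k x" unfolding H_def by (intro summable_LIMSEQ) simp
        moreover have "0 \<le> H k x" unfolding H_def using elim by (intro suminf_nonneg) (auto simp: g_def)
        ultimately show ?case using inc by simp
      qed
    qed (auto simp: g_def intro!: sum_nonneg)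
    also have "\<dots> \<le> ennreal (2 * C * \<delta> k)" by (intro SUP_least tail)
    finally show ?thesis .
  qed
  have fin_close: "\<nu> (\<lambda>x. v k x - f x) < top" for k
    using close[of k] by (rule le_less_trans) simp
  have "\<nu> (\<lambda>x. v 0 x - (v 0 x - f x)) < top"
    by (rule finite_diff[OF _ _ _ fin_close]) (simp_all add: v_def fin)
  then have fin_f: "\<nu> f < top" by simp
  have bound: "enn2real (\<nu> (\<lambda>x. u n x - f x)) \<le> C * (\<delta> k + 2 * C * \<delta> k)" if "ix k \<le> n" for n k
  proof -
    have split: "(\<lambda>x. (u n x - v k x) + (v k x - f x)) = (\<lambda>x. u n x - f x)"
      by (rule ext) simp
    have "enn2real (\<nu> (\<lambda>x. (u n x - v k x) + (v k x - f x)))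
        \<le> C * (enn2real (\<nu> (\<lambda>x. u n x - v k x)) + enn2real (\<nu> (\<lambda>x. v k x - f x)))"
      using finite_diff[of "u n" "v k"] fin fin_close by (intro real_add) (simp_all add: v_def)
    also have "\<dots> \<le> C * (\<delta> k + 2 * C * \<delta> k)"
    proof (intro mult_left_mono add_mono)
      show "enn2real (\<nu> (\<lambda>x. u n x - v k x)) \<le> \<delta> k"
        using K[of k n "ix k"] ix(1)[of k] that by (simp add: v_def)
      show "enn2real (\<nu> (\<lambda>x. v k x - f x)) \<le> 2 * C * \<delta> k"
        by (rule enn2real_leI[OF _ close]) (use \<delta>_pos[of k] C_ge_1 in simp)
    qed (use C_ge_1 in simp)
    finally show ?thesis unfolding split .
  qed
  have \<delta>_lim: "(\<lambda>k. C * (\<delta> k + 2 * C * \<delta> k)) \<longlonglongrightarrow> 0"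
  proof -
    have "\<delta> \<longlonglongrightarrow> 0" unfolding \<delta>_def using C_ge_1 by (intro LIMSEQ_realpow_zero) (auto simp: field_simps)
    from tendsto_mult_right_zero[OF tendsto_add_zero[OF this tendsto_mult_right_zero[OF this, of "2 * C"]], of C]
    show ?thesis by simp
  qed
  have "(\<lambda>n. enn2real (\<nu> (\<lambda>x. u n x - f x))) \<longlonglongrightarrow> 0"
  proof (rule LIMSEQ_I)
    fix e :: real assume "0 < e"
    with order_tendstoD(2)[OF \<delta>_lim] have "\<exists>k. C * (\<delta> k + 2 * C * \<delta> k) < e"
      unfolding eventually_sequentially by blast
    then obtain k where "C * (\<delta> k + 2 * C * \<delta> k) < e" ..
    then have "norm (enn2real (\<nu> (\<lambda>x. u n x - f x)) - 0) < e" if "ix k \<le> n" for n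
      using bound[OF that] by simp
    then show "\<exists>n0. \<forall>n\<ge>n0. norm (enn2real (\<nu> (\<lambda>x. u n x - f x)) - 0) < e" by blast
  qed
  then show ?thesis using fin_f by (intro bexI[of _ f]) auto
qed

end

lemma function_quasi_norm_imp_ideal_space:
  assumes "function_quasi_norm (lebesgue_on \<Omega>) C \<nu>"
    and g: "g \<in> borel_measurable (lebesgue_on \<Omega>)" "\<nu> g < top" "\<And>x. x \<in> \<Omega> \<Longrightarrow> 0 < g x"
  defines "F \<equiv> {f \<in> borel_measurable (lebesgue_on \<Omega>). \<nu> f < top}" and "N \<equiv> \<lambda>f. enn2real (\<nu> f)"
  shows "quasi_Banach_ideal_space \<Omega> F N" "Fatou_property \<Omega> F N" "C = 1 \<Longrightarrow> Banach_ideal_space \<Omega> F N"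
proof -
  interpret function_quasi_norm "lebesgue_on \<Omega>" C \<nu> by fact
  have lin: "linear_subspace_L0 \<Omega> F"
    using vanishing[of "\<lambda>x. 0"] cmult finite_add
    by (auto simp: linear_subspace_L0_def F_def ennreal_mult_less_top)
  have tri: "N (\<lambda>x. f x + g x) \<le> C * (N f + N g)" if "f \<in> F" "g \<in> F" for f g
    using real_add that by (auto simp: F_def N_def)
  have hom: "N (\<lambda>x. c * f x) = \<bar>c\<bar> * N f" if "f \<in> F" for c f
    using cmult that by (auto simp: F_def N_def enn2real_mult)
  have def: "0 \<le> N f \<and> (N f = 0 \<longleftrightarrow> (AE x in lebesgue_on \<Omega>. f x = 0))" if "f \<in> F" for f
    using eq_0_iff that by (auto simp: F_def N_def enn2real_eq_0_iff)
  have ideal: "f \<in> F \<and> N f \<le> N g"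
    if "f \<in> borel_measurable (lebesgue_on \<Omega>)" "g \<in> F" "AE x in lebesgue_on \<Omega>. \<bar>f x\<bar> \<le> \<bar>g x\<bar>" for f g
    using mono[of f g] that by (auto simp: F_def N_def intro: le_less_trans enn2real_mono)
  have quasi: "quasi_normed_ideal_space \<Omega> F N"
    unfolding quasi_normed_ideal_space_def quasi_norm_on_def
    using lin tri hom def ideal C_ge_1 g by (auto simp: F_def intro!: exI[of _ C] bexI[of _ g])
  have comp: "complete_on F N"
    unfolding complete_on_def
  proof (intro allI impI, elim conjE)
    fix u :: "nat \<Rightarrow> 'a \<Rightarrow> real"
    assume u: "\<forall>n. u n \<in> F" "\<forall>\<epsilon>>0. \<exists>n0. \<forall>m\<ge>n0. \<forall>n\<ge>n0. N (\<lambda>x. u m x - u n x) < \<epsilon>"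
    then show "\<exists>f\<in>F. (\<lambda>n. N (\<lambda>x. u n x - f x)) \<longlonglongrightarrow> 0"
      using complete[of u] by (auto simp: F_def N_def)
  qed
  show "quasi_Banach_ideal_space \<Omega> F N"
    using quasi comp by (simp add: quasi_Banach_ideal_space_def)
  show "Banach_ideal_space \<Omega> F N" if "C = 1"
    using quasi comp tri hom def that by (auto simp: Banach_ideal_space_def norm_on_def)
  show "Fatou_property \<Omega> F N"
    unfolding Fatou_property_def
  proof (intro ballI allI impI, elim conjE)
    fix f u
    assume f: "f \<in> borel_measurable (lebesgue_on \<Omega>)"
      and u: "\<forall>n::nat. u n \<in> F \<and> (AE x in lebesgue_on \<Omega>. 0 \<le> u n x)"
      and lim: "AE x in lebesgue_on \<Omega>. incseq (\<lambda>n. u n x) \<and> (\<lambda>n. u n x) \<longlonglongrightarrow> \<bar>f x\<bar>"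
      and bdd: "bdd_above (range (\<lambda>n. N (u n)))"
    have meas: "u n \<in> borel_measurable (lebesgue_on \<Omega>)" and fin: "\<nu> (u n) < top" for n
      using u by (auto simp: F_def)
    obtain B where B: "\<And>n. N (u n) \<le> B" using bdd by (auto simp: bdd_above_def)
    have "\<nu> (u n) \<le> ennreal B" for n
      using B[of n] fin[of n] by (metis N_def ennreal_enn2real ennreal_leI)
    moreover have "\<nu> f \<le> (SUP n. \<nu> (u n))"
      using u by (intro Fatou f meas lim) auto
    ultimately have "\<nu> f \<le> ennreal B" by (meson SUP_least order.trans)
    then have fin_f: "\<nu> f < top" by (rule le_less_trans) simp
    have pos: "AE x in lebesgue_on \<Omega>. \<forall>n. 0 \<le> u n x" using u by (simp add: AE_all_countable)
    have le: "\<nu> (u n) \<le> \<nu> f" for n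
      using lim pos by (intro mono meas f, eventually_elim) (auto intro: incseq_le)
    have "(SUP n. \<nu> (u n)) = \<nu> f"
      using \<open>\<nu> f \<le> (SUP n. \<nu> (u n))\<close> le by (intro antisym SUP_least) auto
    moreover have "incseq (\<lambda>n. \<nu> (u n))"
      using lim u by (intro incseq_of_AE_incseq[where M = "lebesgue_on \<Omega>"] mono meas)
        (auto elim: eventually_mono)
    ultimately have "(\<lambda>n. \<nu> (u n)) \<longlonglongrightarrow> \<nu> f" using LIMSEQ_SUP by metis
    then have "(\<lambda>n. N (u n)) \<longlonglongrightarrow> N f"
      unfolding N_def using fin_f by (intro tendsto_enn2real) auto
    then show "f \<in> F \<and> (\<lambda>n. N (u n)) \<longlonglongrightarrow> N f" using f fin_f by (simp add: F_def)
  qed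
qed

section \<open>The Lorentz quasi-norms\<close>

text \<open>
  The constant comes from \<open>(f + g)\<^sup>*(t) \<le> f\<^sup>*(t/2) + g\<^sup>*(t/2)\<close>: the dilation contributes \<open>2\<^bsup>1/p\<^esup>\<close> and
  the addition \<open>Lr_const r\<close>. It is the same for all measure spaces.
\<close>

lemma lorentz_function_quasi_norm:
  assumes r: "0 < r"
  shows "function_quasi_norm M (2 powr enn2real (1 / p) * Lr_const r) (lorentz_norm p r M)"
proof
  have "1 \<le> (2::real) powr enn2real (1 / p)" by (rule ge_one_powr_ge_zero) simp_all
  then show "1 \<le> 2 powr enn2real (1 / p) * Lr_const r"
    using mult_mono[of 1 "2 powr enn2real (1 / p)" 1 "Lr_const r"] Lr_const_ge_1[of r] by simp
next
  fix f g :: "'a \<Rightarrow> real"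
  assume [measurable]: "f \<in> borel_measurable M" "g \<in> borel_measurable M" and "AE x in M. \<bar>f x\<bar> \<le> \<bar>g x\<bar>"
  then show "lorentz_norm p r M f \<le> lorentz_norm p r M g"
    unfolding lorentz_norm_def using r by (intro lorentz_functional_mono rearr_mono_AE) auto
next
  fix c and f :: "'a \<Rightarrow> real" assume [measurable]: "f \<in> borel_measurable M"
  then show "lorentz_norm p r M (\<lambda>x. c * f x) = ennreal \<bar>c\<bar> * lorentz_norm p r M f"
    unfolding lorentz_norm_def using r
    by (subst lorentz_functional_cmult[symmetric]) (auto intro!: arg_cong[where f = "lorentz_functional p r"] rearr_cmult)
next
  fix f g :: "'a \<Rightarrow> real"
  assume [measurable]: "f \<in> borel_measurable M" "g \<in> borel_measurable M"
  have "lorentz_norm p r M (\<lambda>x. f x + g x)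
     \<le> lorentz_functional p r (\<lambda>t. rearr M f (t / 2) + rearr M g (t / 2))"
    unfolding lorentz_norm_def
  proof (rule lorentz_functional_mono[OF r])
    fix t :: real assume "0 < t"
    then show "rearr M (\<lambda>x. f x + g x) t \<le> rearr M f (t / 2) + rearr M g (t / 2)"
      using rearr_add[of f M g "t / 2" "t / 2"] by simp
  qed measurable
  also have "\<dots> \<le> ennreal (Lr_const r) * (lorentz_functional p r (\<lambda>t. rearr M f (t / 2))
     + lorentz_functional p r (\<lambda>t. rearr M g (t / 2)))"
    by (rule lorentz_functional_add[OF r]) measurable
  also have "\<dots> = ennreal (2 powr enn2real (1 / p) * Lr_const r) * (lorentz_norm p r M f + lorentz_norm p r M g)"
    using Lr_const_ge_1[of r]
    by (simp add: lorentz_norm_def lorentz_functional_dilate[OF r] ennreal_mult distrib_left mult_ac)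
  finally show "lorentz_norm p r M (\<lambda>x. f x + g x)
     \<le> ennreal (2 powr enn2real (1 / p) * Lr_const r) * (lorentz_norm p r M f + lorentz_norm p r M g)" .
next
  fix f :: "'a \<Rightarrow> real"
  assume [measurable]: "f \<in> borel_measurable M" and 0: "lorentz_norm p r M f = 0"
  have "AE t in lborel. 0 < t \<longrightarrow> rearr M f t = 0"
    using 0 by (intro lorentz_functional_eq_0[OF r]) (auto simp: lorentz_norm_def)
  then show "AE x in M. f x = 0"
    by (intro rearr_eq_0_imp_AE antimono_AE_0_imp_0 rearr_antimono) auto
next
  fix f :: "'a \<Rightarrow> real" and u :: "nat \<Rightarrow> 'a \<Rightarrow> real"
  assume [measurable]: "f \<in> borel_measurable M" "\<And>n. u n \<in> borel_measurable M"
    and inc: "AE x in M. incseq (\<lambda>n. u n x) \<and> (\<lambda>n. u n x) \<longlonglongrightarrow> \<bar>f x\<bar>"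
    and pos: "\<And>n. AE x in M. 0 \<le> u n x"
  have "lorentz_norm p r M f \<le> lorentz_functional p r (\<lambda>t. SUP n. rearr M (u n) t)"
    unfolding lorentz_norm_def
    by (intro lorentz_functional_mono[OF r] rearr_Fatou inc pos) measurable
  also have "\<dots> = (SUP n. lorentz_norm p r M (u n))"
    unfolding lorentz_norm_def
    using inc pos by (intro lorentz_functional_SUP[OF r] incseq_of_AE_incseq[where M = M] rearr_mono_AE) auto
  finally show "lorentz_norm p r M f \<le> (SUP n. lorentz_norm p r M (u n))" .
qed

lemma (in function_quasi_norm) function_norm_if_subadditive:
  assumes "\<And>f g. f \<in> borel_measurable M \<Longrightarrow> g \<in> borel_measurable M \<Longrightarrow> \<nu> f < top \<Longrightarrow> \<nu> g < top
     \<Longrightarrow> \<nu> (\<lambda>x. f x + g x) \<le> \<nu> f + \<nu> g"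
  shows "function_quasi_norm M 1 \<nu>"
proof
  fix f g :: "'a \<Rightarrow> real"
  assume "f \<in> borel_measurable M" "g \<in> borel_measurable M"
  then have "\<nu> (\<lambda>x. f x + g x) \<le> \<nu> f + \<nu> g"
    by (cases "\<nu> f < top \<and> \<nu> g < top") (auto intro: assms simp flip: less_top)
  then show "\<nu> (\<lambda>x. f x + g x) \<le> ennreal 1 * (\<nu> f + \<nu> g)" by simp
qed (use mono cmult definite Fatou in blast)+

text \<open>
  For \<open>p = r = \<infinity>\<close> the constant of the quasi-triangle inequality already is \<open>1\<close>. For \<open>r \<le> p < \<infinity>\<close> the
  quasi-triangle inequality supplies the finiteness of the norm of \<open>f + g\<close> that the absorption
  argument behind Hardy's lemma requires.
\<close>

lemma lorentz_function_norm:
  assumes "sigma_finite_measure M"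
    and pr: "(1 \<le> r \<and> r \<le> p \<and> p < \<infinity>) \<or> (p = \<infinity> \<and> r = \<infinity>)"
  shows "function_quasi_norm M 1 (lorentz_norm p r M)"
proof (cases "p = \<infinity>")
  case True
  then show ?thesis
    using lorentz_function_quasi_norm[of \<infinity> M \<infinity>] pr by (simp add: Lr_const_def)
next
  case False
  then have pr: "1 \<le> r" "r \<le> p" "p < \<infinity>" using pr by auto
  have r: "0 < r" using pr(1) by (rule less_le_trans[rotated]) simp
  interpret function_quasi_norm M "2 powr enn2real (1 / p) * Lr_const r" "lorentz_norm p r M"
    by (rule lorentz_function_quasi_norm[OF r])
  show ?thesis
  proof (rule function_norm_if_subadditive)
    fix f g :: "'a \<Rightarrow> real"
    assume [measurable]: "f \<in> borel_measurable M" "g \<in> borel_measurable M"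
      and fin: "lorentz_norm p r M f < top" "lorentz_norm p r M g < top"
    have "lorentz_norm p r M (\<lambda>x. f x + g x) < top" using fin by (intro finite_add) auto
    then have "lorentz_norm p r M (\<lambda>x. f x + g x) \<le> lorentz_functional p r (\<lambda>t. rearr M f t + rearr M g t)"
      unfolding lorentz_norm_def using pr assms(1)
      by (intro lorentz_functional_le_of_integrals_le)
        (auto simp: distrib_right nn_integral_add intro!: rearr_antimono integral_rearr_add)
    also have "\<dots> \<le> ennreal (Lr_const r) * (lorentz_norm p r M f + lorentz_norm p r M g)"
      unfolding lorentz_norm_def by (rule lorentz_functional_add[OF r]) measurable
    finally show "lorentz_norm p r M (\<lambda>x. f x + g x) \<le> lorentz_norm p r M f + lorentz_norm p r M g"
      using pr by (simp add: Lr_const_def)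
  qed
qed

text \<open>
  Since \<open>f \<mapsto> f\<^sup>*\<^sup>*\<close> is subadditive, the constant is that of \<open>Lr_norm\<close>. Definiteness is inherited from
  \<open>f\<^sup>*\<close> through \<open>f\<^sup>* \<le> f\<^sup>*\<^sup>*\<close>.
\<close>

lemma lorentz_avg_function_quasi_norm:
  assumes "sigma_finite_measure M" and r: "0 < r"
  shows "function_quasi_norm M (Lr_const r) (lorentz_avg_norm p r M)"
proof
  show "1 \<le> Lr_const r" by (rule Lr_const_ge_1)
next
  fix f g :: "'a \<Rightarrow> real"
  assume [measurable]: "f \<in> borel_measurable M" "g \<in> borel_measurable M" and "AE x in M. \<bar>f x\<bar> \<le> \<bar>g x\<bar>"
  then show "lorentz_avg_norm p r M f \<le> lorentz_avg_norm p r M g"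
    unfolding lorentz_avg_norm_def using r by (intro lorentz_functional_mono rearr_avg_mono_AE) auto
next
  fix c and f :: "'a \<Rightarrow> real" assume [measurable]: "f \<in> borel_measurable M"
  then show "lorentz_avg_norm p r M (\<lambda>x. c * f x) = ennreal \<bar>c\<bar> * lorentz_avg_norm p r M f"
    unfolding lorentz_avg_norm_def using r
    by (subst lorentz_functional_cmult[symmetric]) (auto intro!: arg_cong[where f = "lorentz_functional p r"] rearr_avg_cmult)
next
  fix f g :: "'a \<Rightarrow> real"
  assume [measurable]: "f \<in> borel_measurable M" "g \<in> borel_measurable M"
  have "lorentz_avg_norm p r M (\<lambda>x. f x + g x)
     \<le> lorentz_functional p r (\<lambda>t. rearr_avg M f t + rearr_avg M g t)"
    unfolding lorentz_avg_norm_def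
    by (rule lorentz_functional_mono[OF r]) (auto intro: rearr_avg_add assms(1))
  also have "\<dots> \<le> ennreal (Lr_const r) * (lorentz_avg_norm p r M f + lorentz_avg_norm p r M g)"
    unfolding lorentz_avg_norm_def by (rule lorentz_functional_add[OF r]) measurable
  finally show "lorentz_avg_norm p r M (\<lambda>x. f x + g x)
     \<le> ennreal (Lr_const r) * (lorentz_avg_norm p r M f + lorentz_avg_norm p r M g)" .
next
  interpret function_quasi_norm M "2 powr enn2real (1 / p) * Lr_const r" "lorentz_norm p r M"
    by (rule lorentz_function_quasi_norm[OF r])
  fix f :: "'a \<Rightarrow> real"
  assume [measurable]: "f \<in> borel_measurable M" and 0: "lorentz_avg_norm p r M f = 0"
  have "lorentz_norm p r M f \<le> lorentz_avg_norm p r M f"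
    unfolding lorentz_norm_def lorentz_avg_norm_def
    by (intro lorentz_functional_mono[OF r] rearr_le_rearr_avg) auto
  then show "AE x in M. f x = 0" using 0 by (intro definite) auto
next
  fix f :: "'a \<Rightarrow> real" and u :: "nat \<Rightarrow> 'a \<Rightarrow> real"
  assume [measurable]: "f \<in> borel_measurable M" "\<And>n. u n \<in> borel_measurable M"
    and inc: "AE x in M. incseq (\<lambda>n. u n x) \<and> (\<lambda>n. u n x) \<longlonglongrightarrow> \<bar>f x\<bar>"
    and pos: "\<And>n. AE x in M. 0 \<le> u n x"
  have "lorentz_avg_norm p r M f \<le> lorentz_functional p r (\<lambda>t. SUP n. rearr_avg M (u n) t)"
    unfolding lorentz_avg_norm_def
    by (intro lorentz_functional_mono[OF r] rearr_avg_Fatou inc pos) measurable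
  also have "\<dots> = (SUP n. lorentz_avg_norm p r M (u n))"
    unfolding lorentz_avg_norm_def
    using inc pos by (intro lorentz_functional_SUP[OF r] incseq_of_AE_incseq[where M = M] rearr_avg_mono_AE) auto
  finally show "lorentz_avg_norm p r M f \<le> (SUP n. lorentz_avg_norm p r M (u n))" .
qed

section \<open>Constants have finite Lorentz norm on a set of finite measure\<close>

lemma nn_integral_powr_head:
  assumes "-1 < b" "0 \<le> c"
  shows "(\<integral>\<^sup>+t\<in>{0<..<c}. ennreal (t powr b) \<partial>lborel) < top"
proof -
  have "(\<integral>\<^sup>+t\<in>{0<..<c}. ennreal (t powr b) \<partial>lborel) \<le> (\<integral>\<^sup>+t\<in>{0..c}. ennreal (t powr b) \<partial>lborel)"
    by (intro nn_integral_mono) (auto simp: indicator_def)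
  also have "\<dots> < top"
    by (subst nn_integral_has_integral_lebesgue'[OF _ has_integral_powr_from_0[OF assms]]) simp_all
  finally show ?thesis .
qed

lemma nn_integral_powr_tail:
  assumes "b < -1" "0 < c"
  shows "(\<integral>\<^sup>+t\<in>{c..}. ennreal (t powr b) \<partial>lborel) < top"
  by (subst nn_integral_has_integral_lebesgue'[OF _ has_integral_powr_to_inf[OF assms]]) simp_all

text \<open>
  For \<open>r < \<infinity>\<close> the integrand near \<open>0\<close> is \<open>t\<^bsup>r/p - 1\<^esup>\<close>, integrable because \<open>r/p > 0\<close>.
\<close>

lemma lorentz_functional_head_finite:
  assumes r: "0 < r" and p: "0 < p" "r \<noteq> \<infinity> \<Longrightarrow> p < \<infinity>" and c: "0 \<le> c"
  shows "lorentz_functional p r (indicator {..<c}) < top"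
  using r
proof (cases rule: exponent_cases)
  case top
  have "(SUP t\<in>{0<..}. ennreal (t powr enn2real (1 / p)) * indicator {..<c} t) \<le> ennreal (c powr enn2real (1 / p))"
    by (rule SUP_least) (auto simp: indicator_def intro!: ennreal_leI powr_mono2)
  then show ?thesis using top by (auto simp: lorentz_functional_def intro: le_less_trans)
next
  case (finite s)
  then obtain P where P: "p = ennreal P" "0 < P" using p by (cases p) auto
  have a: "enn2real (1 / p) = 1 / P" using P by (subst enn2real_inverse) auto
  have "(\<integral>\<^sup>+t\<in>{0<..}. enn_powr (ennreal (t powr (1 / P)) * indicator {..<c} t) s * ennreal (1 / t) \<partial>lborel)
    = (\<integral>\<^sup>+t\<in>{0<..<c}. ennreal (t powr (s / P - 1)) \<partial>lborel)"
  proof (rule nn_integral_cong)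
    fix t :: real
    show "enn_powr (ennreal (t powr (1 / P)) * indicator {..<c} t) s * ennreal (1 / t) * indicator {0<..} t
       = ennreal (t powr (s / P - 1)) * indicator {0<..<c} t"
      by (auto simp: indicator_def enn_powr_ennreal powr_powr powr_diff simp flip: ennreal_mult)
  qed
  also have "\<dots> < top" using finite P c by (intro nn_integral_powr_head) auto
  finally show ?thesis
    using finite a by (simp add: lorentz_functional_def enn_powr_less_top_iff)
qed

text \<open>
  For \<open>r < \<infinity>\<close> the integrand near \<open>\<infinity>\<close> is \<open>t\<^bsup>r (1/p - 1) - 1\<^esup>\<close>, integrable because \<open>p > 1\<close>.
\<close>

lemma lorentz_functional_tail_finite:
  assumes r: "0 < r" and p: "1 < p" and c: "0 < c"
  shows "lorentz_functional p r (\<lambda>t. ennreal (1 / t) * indicator {c..} t) < top"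
proof -
  have a: "enn2real (1 / p) < 1"
  proof (cases p)
    case (real P)
    then have "1 < P" using p by (simp add: ennreal_less_iff flip: ennreal_1)
    then show ?thesis using real by (subst enn2real_inverse) auto
  qed simp
  show ?thesis using r
  proof (cases rule: exponent_cases)
    case top
    have "(SUP t\<in>{0<..}. ennreal (t powr enn2real (1 / p)) * (ennreal (1 / t) * indicator {c..} t))
       \<le> ennreal (c powr (enn2real (1 / p) - 1))"
    proof (rule SUP_least)
      fix t :: real assume "t \<in> {0<..}"
      then have "ennreal (t powr enn2real (1 / p)) * ennreal (1 / t) = ennreal (t powr (enn2real (1 / p) - 1))"
        by (simp add: powr_diff flip: ennreal_mult)
      moreover have "t powr (enn2real (1 / p) - 1) \<le> c powr (enn2real (1 / p) - 1)" if "c \<le> t"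
        using a c that by (intro powr_mono2') auto
      ultimately show "ennreal (t powr enn2real (1 / p)) * (ennreal (1 / t) * indicator {c..} t)
         \<le> ennreal (c powr (enn2real (1 / p) - 1))"
        by (auto simp: indicator_def intro: ennreal_leI)
    qed
    then show ?thesis using top by (auto simp: lorentz_functional_def intro: le_less_trans)
  next
    case (finite s)
    let ?b = "s * (enn2real (1 / p) - 1)"
    have "(\<integral>\<^sup>+t\<in>{0<..}. enn_powr (ennreal (t powr enn2real (1 / p)) * (ennreal (1 / t) * indicator {c..} t)) s * ennreal (1 / t) \<partial>lborel)
      = (\<integral>\<^sup>+t\<in>{c..}. ennreal (t powr (?b - 1)) \<partial>lborel)"
    proof (rule nn_integral_cong)
      fix t :: real
      show "enn_powr (ennreal (t powr enn2real (1 / p)) * (ennreal (1 / t) * indicator {c..} t)) s * ennreal (1 / t) * indicator {0<..} t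
         = ennreal (t powr (?b - 1)) * indicator {c..} t"
      proof (cases "c \<le> t")
        case True
        then have t: "0 < t" using c by simp
        have "ennreal (t powr enn2real (1 / p)) * ennreal (1 / t) = ennreal (t powr (enn2real (1 / p) - 1))"
          using t by (simp add: powr_diff flip: ennreal_mult)
        moreover have "enn_powr (ennreal (t powr (enn2real (1 / p) - 1))) s = ennreal (t powr ?b)"
          by (simp add: enn_powr_ennreal powr_powr mult.commute)
        moreover have "ennreal (t powr ?b) * ennreal (1 / t) = ennreal (t powr (?b - 1))"
          using t by (simp add: powr_diff[of t ?b] flip: ennreal_mult)
        ultimately show ?thesis using True t by simp
      qed simp
    qed
    also have "\<dots> < top" using a finite c by (intro nn_integral_powr_tail) (auto simp: mult_pos_neg)
    finally show ?thesis
      using finite by (simp add: lorentz_functional_def enn_powr_less_top_iff)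
  qed
qed

lemma rearr_one_le:
  assumes "finite_measure M"
  shows "rearr M (\<lambda>x. 1) t \<le> indicator {..<measure M (space M)} t"
proof (cases "t < measure M (space M)")
  case True
  have "rearr M (\<lambda>x. 1) t \<le> ennreal 1" by (subst rearr_le_iff) auto
  then show ?thesis using True by simp
next
  case False
  then have "emeasure M (space M) \<le> ennreal t"
    using assms by (simp add: finite_measure.emeasure_eq_measure ennreal_leI)
  then have "rearr M (\<lambda>x. 1) t \<le> ennreal 0" by (subst rearr_le_iff) auto
  then show ?thesis by simp
qed

lemma lorentz_norm_one_finite:
  assumes "finite_measure M" and r: "0 < r" and p: "0 < p" "r \<noteq> \<infinity> \<Longrightarrow> p < \<infinity>"
  shows "lorentz_norm p r M (\<lambda>x. 1) < top"
proof -
  have "lorentz_norm p r M (\<lambda>x. 1) \<le> lorentz_functional p r (indicator {..<measure M (space M)})"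
    unfolding lorentz_norm_def by (intro lorentz_functional_mono[OF r] rearr_one_le assms) measurable
  also have "\<dots> < top" using p by (intro lorentz_functional_head_finite[OF r]) auto
  finally show ?thesis .
qed

lemma rearr_avg_one_le:
  assumes "finite_measure M" and t: "0 < t"
  shows "rearr_avg M (\<lambda>x. 1) t \<le> 1" "rearr_avg M (\<lambda>x. 1) t \<le> ennreal (measure M (space M)) * ennreal (1 / t)"
proof -
  let ?m = "measure M (space M)"
  have le: "(\<integral>\<^sup>+s\<in>{0<..<t}. rearr M (\<lambda>x. 1) s \<partial>lborel) \<le> (\<integral>\<^sup>+s. indicator {0<..<t} s * indicator {..<?m} s \<partial>lborel)"
    by (subst mult.commute) (intro nn_integral_mono mult_left_mono rearr_one_le assms, simp)
  also have "\<dots> \<le> (\<integral>\<^sup>+s. indicator {0<..<t} s \<partial>lborel)"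
    by (intro nn_integral_mono) (auto simp: indicator_def)
  also have "\<dots> = ennreal t" using t by simp
  finally show "rearr_avg M (\<lambda>x. 1) t \<le> 1"
    using divide_right_mono_ennreal[of _ "ennreal t" "ennreal t"] t by (simp add: rearr_avg_def divide_ennreal)
  note le
  also have "(\<integral>\<^sup>+s. indicator {0<..<t} s * indicator {..<?m} s \<partial>lborel) \<le> (\<integral>\<^sup>+s. indicator {0<..<?m} s \<partial>lborel)"
    by (intro nn_integral_mono) (auto simp: indicator_def)
  also have "\<dots> = ennreal ?m" by simp
  finally show "rearr_avg M (\<lambda>x. 1) t \<le> ennreal ?m * ennreal (1 / t)"
    using divide_right_mono_ennreal[of _ "ennreal ?m" "ennreal t"] t
    by (simp add: rearr_avg_def divide_ennreal flip: ennreal_mult)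
qed

text \<open>
  On a space of measure \<open>m\<close> the averaged rearrangement of the constant \<open>1\<close> is at most \<open>1\<close> before
  \<open>t = 1\<close> and at most \<open>m / t\<close> afterwards.
\<close>

lemma lorentz_avg_norm_one_finite:
  assumes "finite_measure M" and r: "0 < r" and p: "(1 < p \<and> p < \<infinity>) \<or> (p = \<infinity> \<and> r = \<infinity>)"
  shows "lorentz_avg_norm p r M (\<lambda>x. 1) < top"
proof -
  let ?m = "measure M (space M)"
  let ?head = "indicator {..<1} :: real \<Rightarrow> ennreal"
  let ?tail = "\<lambda>t. ennreal (1 / t) * indicator {1..} t"
  have p': "1 < p" "0 < p" using p by (auto intro: le_less_trans[of _ 1])
  have "lorentz_avg_norm p r M (\<lambda>x. 1) \<le> lorentz_functional p r (\<lambda>t. ?head t + ennreal ?m * ?tail t)"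
    unfolding lorentz_avg_norm_def
  proof (rule lorentz_functional_mono[OF r])
    fix t :: real assume "0 < t"
    from rearr_avg_one_le[OF assms(1) this]
    show "rearr_avg M (\<lambda>x. 1) t \<le> ?head t + ennreal ?m * ?tail t"
      by (cases "t < 1") (auto simp: indicator_def)
  qed measurable
  also have "\<dots> \<le> ennreal (Lr_const r) * (lorentz_functional p r ?head + lorentz_functional p r (\<lambda>t. ennreal ?m * ?tail t))"
    by (rule lorentz_functional_add[OF r]) measurable
  also have "lorentz_functional p r (\<lambda>t. ennreal ?m * ?tail t) = ennreal ?m * lorentz_functional p r ?tail"
    by (rule lorentz_functional_cmult[OF r]) measurable
  also have "ennreal (Lr_const r) * (lorentz_functional p r ?head + ennreal ?m * lorentz_functional p r ?tail) < top"
  proof -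
    have "lorentz_functional p r ?head < top"
      using p p' by (intro lorentz_functional_head_finite[OF r]) auto
    moreover have "lorentz_functional p r ?tail < top"
      using p' by (intro lorentz_functional_tail_finite[OF r]) auto
    ultimately show ?thesis by (simp add: ennreal_mult_less_top)
  qed
  finally show ?thesis .
qed

section \<open>Herz spaces over function quasi-norms\<close>

lemma infsum_eq_nn_integral_count_space:
  fixes f :: "int \<Rightarrow> ennreal"
  shows "(\<Sum>\<^sub>\<infinity>k\<in>{-1..}. f k) = (\<integral>\<^sup>+k. f k \<partial>count_space {-1..})"
    and nn_integral_shells_eq_suminf: "(\<integral>\<^sup>+k. f k \<partial>count_space {-1..}) = (\<Sum>n. f (int n - 1))"
proof -
  have bij: "bij_betw (\<lambda>n. int n - 1) UNIV {-1..}"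
    by (rule bij_betwI[where g = "\<lambda>k. nat (k + 1)"]) auto
  show eq: "(\<integral>\<^sup>+k. f k \<partial>count_space {-1..}) = (\<Sum>n. f (int n - 1))"
    using nn_integral_bij_count_space[OF bij, of f] by (simp add: nn_integral_count_space_nat)
  have "(\<Sum>\<^sub>\<infinity>k\<in>{-1..}. f k) = (\<Sum>\<^sub>\<infinity>n. f (int n - 1))"
    by (rule infsum_reindex_bij_betw[OF bij, symmetric])
  also have "\<dots> = (\<Sum>n. f (int n - 1))"
    by (intro sums_unique has_sum_imp_sums has_sum_infsum nonneg_summable_on_complete) simp
  finally show "(\<Sum>\<^sub>\<infinity>k\<in>{-1..}. f k) = (\<integral>\<^sup>+k. f k \<partial>count_space {-1..})"
    by (simp add: eq)
qed

lemma herz_norm_eq_Lr_norm: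
  assumes "0 < q"
  shows "herz_norm \<nu> a q \<Omega> f = Lr_norm (count_space {-1..}) q
    (\<lambda>k. ennreal (2 powr (real_of_int k * a)) * \<nu> (lebesgue_on (shell \<Omega> k)) (cut \<Omega> k f))"
  using assms
proof (cases rule: exponent_cases)
  case (finite s)
  then show ?thesis
    by (simp add: herz_norm_def Lr_norm_def infsum_eq_nn_integral_count_space enn_powr_mult
        enn_powr_ennreal powr_powr)
qed (simp add: herz_norm_def Lr_norm_def)

lemma le_Lr_norm_count_space:
  assumes "0 < q" "k \<in> A"
  shows "u k \<le> Lr_norm (count_space A) q u"
  using assms(1)
proof (cases rule: exponent_cases)
  case top
  then show ?thesis using assms(2) by (simp add: Lr_norm_def SUP_upper)
next
  case (finite s)
  then show ?thesis
    using nn_integral_ge_point[OF assms(2), of "\<lambda>k. enn_powr (u k) s"]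
    by (simp add: Lr_norm_def enn_powr_le_iff)
qed

lemma shell_subset: "shell \<Omega> k \<subseteq> \<Omega>"
  by (auto simp: shell_def)

lemma sets_shell:
  assumes "\<Omega> \<in> sets lebesgue"
  shows "shell \<Omega> k \<in> sets lebesgue"
proof -
  have "shell \<Omega> k = \<Omega> \<inter> (if k = -1 then {x. norm x < 1 / 2} else {x. 2 powi (k - 1) \<le> norm x \<and> norm x < 2 powi k})"
    by (auto simp: shell_def)
  also have "\<dots> \<in> sets lebesgue"
    by (rule sets.Int[OF assms]) (simp add: sets_completionI_sets)
  finally show ?thesis .
qed

lemma finite_measure_shell:
  assumes "\<Omega> \<in> sets lebesgue"
  shows "finite_measure (lebesgue_on (shell \<Omega> k))"
proof -
  have "shell \<Omega> k \<subseteq> ball 0 (if k = -1 then 1 / 2 else 2 powi k)"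
    by (auto simp: shell_def dist_norm)
  then have "bounded (shell \<Omega> k)" by (rule bounded_subset[OF bounded_ball])
  then show ?thesis
    using sets_shell[OF assms] by (intro finite_measure_lebesgue_on bounded_set_imp_lmeasurable)
qed

text \<open>
  For \<open>k \<ge> -1\<close> the \<open>k\<close>-th shell is the part of \<open>\<Omega>\<close> where this function takes the value \<open>k\<close>
  (\<open>mem_shell_iff\<close>), which shows at once that the shells partition \<open>\<Omega>\<close>.
\<close>

definition shell_index :: "'a::real_normed_vector \<Rightarrow> int" where
  "shell_index x = (if norm x < 1 / 2 then -1 else \<lfloor>log 2 (norm x)\<rfloor> + 1)"

lemma shell_index_ge: "-1 \<le> shell_index x"
proof (cases "norm x < 1 / 2")
  case False
  then have "-1 \<le> log 2 (norm x)" by (subst le_log_iff) (auto simp: powr_minus)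
  then have "-1 \<le> \<lfloor>log 2 (norm x)\<rfloor>" by (simp add: le_floor_iff)
  then show ?thesis using False by (simp add: shell_index_def)
qed (simp add: shell_index_def)

lemma mem_shell_iff:
  assumes "-1 \<le> k"
  shows "x \<in> shell \<Omega> k \<longleftrightarrow> x \<in> \<Omega> \<and> shell_index x = k"
proof (cases "norm x < 1 / 2")
  case True
  have "(1/2::real) \<le> 2 powi (k - 1)" if "k \<noteq> -1"
    using power_int_increasing[of "-1" "k - 1" "2::real"] that assms by (simp add: power_int_minus)
  then show ?thesis using True by (auto simp: shell_def shell_index_def)
next
  case False
  then have pos: "0 < norm x" by auto
  have "2 powi (k - 1) \<le> norm x \<and> norm x < 2 powi k \<longleftrightarrow> \<lfloor>log 2 (norm x)\<rfloor> = k - 1"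
  proof -
    have "2 powi m = 2 powr real_of_int m" for m by (simp add: powr_real_of_int')
    then show ?thesis using pos
      by (simp add: floor_eq_iff le_log_iff log_less_iff)
  qed
  moreover have "shell_index x \<noteq> -1"
  proof -
    have "-1 \<le> log 2 (norm x)" using False by (subst le_log_iff) (auto simp: powr_minus)
    then have "-1 \<le> \<lfloor>log 2 (norm x)\<rfloor>" by (simp add: le_floor_iff)
    then show ?thesis using False by (simp add: shell_index_def)
  qed
  ultimately show ?thesis using False by (auto simp: shell_def shell_index_def)
qed

lemma measurable_shell_index:
  assumes "\<Omega> \<in> sets lebesgue"
  shows "shell_index \<in> measurable (lebesgue_on \<Omega>) (count_space {-1..})"
proof (subst measurable_count_space_eq_countable, simp, intro conjI ballI)
  show "shell_index \<in> space (lebesgue_on \<Omega>) \<rightarrow> {-1..}" by (auto simp: shell_index_ge)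
  fix k :: int assume "k \<in> {-1..}"
  then have "shell_index -` {k} \<inter> space (lebesgue_on \<Omega>) = shell \<Omega> k"
    using mem_shell_iff[of k _ \<Omega>] by auto
  then show "shell_index -` {k} \<inter> space (lebesgue_on \<Omega>) \<in> sets (lebesgue_on \<Omega>)"
    using sets_shell[OF assms] shell_subset assms by (auto simp: sets_restrict_space_iff)
qed

lemma AE_shell:
  assumes "\<Omega> \<in> sets lebesgue" "AE x in lebesgue_on \<Omega>. P x"
  shows "AE x in lebesgue_on (shell \<Omega> k). P x"
  using assms sets_shell[OF assms(1), of k] shell_subset[of \<Omega> k]
  by (auto simp: AE_restrict_space_iff elim: eventually_mono)

lemma measurable_cut:
  assumes "\<Omega> \<in> sets lebesgue" "f \<in> borel_measurable (lebesgue_on \<Omega>)"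
  shows "cut \<Omega> k f \<in> borel_measurable (lebesgue_on (shell \<Omega> k))"
proof -
  have "f \<in> borel_measurable (lebesgue_on (shell \<Omega> k))"
    by (rule measurable_restrict_mono[OF assms(2) shell_subset])
  moreover have "f x = cut \<Omega> k f x" if "x \<in> space (lebesgue_on (shell \<Omega> k))" for x
    using that by (simp add: cut_def)
  ultimately show ?thesis using measurable_cong by blast
qed

text \<open>
  One constant \<open>C\<close> serves all shells; this makes the quasi-triangle inequalities summable over \<open>k\<close>.
\<close>

locale herz_family =
  fixes \<Omega> :: "'a::euclidean_space set" and C :: real
    and \<nu> :: "'a measure \<Rightarrow> ('a \<Rightarrow> real) \<Rightarrow> ennreal" and a :: real and q :: ennreal
  assumes \<Omega>: "\<Omega> \<in> sets lebesgue" and q: "0 < q"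
    and loc: "\<And>k. function_quasi_norm (lebesgue_on (shell \<Omega> k)) C (\<nu> (lebesgue_on (shell \<Omega> k)))"
begin

abbreviation weighted_norm :: "('a \<Rightarrow> real) \<Rightarrow> int \<Rightarrow> ennreal" where
  "weighted_norm f k \<equiv> ennreal (2 powr (real_of_int k * a)) * \<nu> (lebesgue_on (shell \<Omega> k)) (cut \<Omega> k f)"

lemma herz_eq: "herz_norm \<nu> a q \<Omega> f = Lr_norm (count_space {-1..}) q (weighted_norm f)"
  by (rule herz_norm_eq_Lr_norm[OF q])

text \<open>
  Each axiom is the corresponding local axiom on every shell followed by the same property of
  \<open>Lr_norm\<close> for counting measure. Definiteness uses that there are only countably many shells.
\<close>

lemma herz_function_quasi_norm:
  "function_quasi_norm (lebesgue_on \<Omega>) (C * Lr_const q) (herz_norm \<nu> a q \<Omega>)"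
proof
  have "1 \<le> C" by (rule function_quasi_norm.C_ge_1[OF loc])
  then show "1 \<le> C * Lr_const q" using mult_mono[of 1 C 1 "Lr_const q"] Lr_const_ge_1[of q] by simp
next
  fix f g :: "'a \<Rightarrow> real"
  assume fg: "f \<in> borel_measurable (lebesgue_on \<Omega>)" "g \<in> borel_measurable (lebesgue_on \<Omega>)"
    and le: "AE x in lebesgue_on \<Omega>. \<bar>f x\<bar> \<le> \<bar>g x\<bar>"
  have "AE x in lebesgue_on (shell \<Omega> k). \<bar>cut \<Omega> k f x\<bar> \<le> \<bar>cut \<Omega> k g x\<bar>" for k
    using AE_shell[OF \<Omega> le] by eventually_elim (auto simp: cut_def indicator_def)
  then show "herz_norm \<nu> a q \<Omega> f \<le> herz_norm \<nu> a q \<Omega> g"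
    unfolding herz_eq using fg
    by (intro Lr_norm_mono[OF q] mult_left_mono function_quasi_norm.mono[OF loc] measurable_cut \<Omega>) auto
next
  fix c and f :: "'a \<Rightarrow> real" assume f: "f \<in> borel_measurable (lebesgue_on \<Omega>)"
  have "cut \<Omega> k (\<lambda>x. c * f x) = (\<lambda>x. c * cut \<Omega> k f x)" for k by (auto simp: cut_def)
  then have "weighted_norm (\<lambda>x. c * f x) = (\<lambda>k. ennreal \<bar>c\<bar> * weighted_norm f k)"
    using function_quasi_norm.cmult[OF loc measurable_cut[OF \<Omega> f]] by (simp add: mult.left_commute)
  then show "herz_norm \<nu> a q \<Omega> (\<lambda>x. c * f x) = ennreal \<bar>c\<bar> * herz_norm \<nu> a q \<Omega> f"
    unfolding herz_eq by (simp add: Lr_norm_cmult[OF q])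
next
  fix f g :: "'a \<Rightarrow> real"
  assume fg: "f \<in> borel_measurable (lebesgue_on \<Omega>)" "g \<in> borel_measurable (lebesgue_on \<Omega>)"
  have C: "1 \<le> C" by (rule function_quasi_norm.C_ge_1[OF loc])
  have "weighted_norm (\<lambda>x. f x + g x) k \<le> ennreal C * (weighted_norm f k + weighted_norm g k)" for k
  proof -
    have "cut \<Omega> k (\<lambda>x. f x + g x) = (\<lambda>x. cut \<Omega> k f x + cut \<Omega> k g x)"
      by (auto simp: cut_def distrib_right)
    then have "weighted_norm (\<lambda>x. f x + g x) k \<le> ennreal (2 powr (real_of_int k * a)) *
       (ennreal C * (\<nu> (lebesgue_on (shell \<Omega> k)) (cut \<Omega> k f) + \<nu> (lebesgue_on (shell \<Omega> k)) (cut \<Omega> k g)))"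
      using function_quasi_norm.add[OF loc measurable_cut[OF \<Omega> fg(1)] measurable_cut[OF \<Omega> fg(2)]]
      by (simp add: mult_left_mono)
    then show ?thesis by (simp add: distrib_left mult.left_commute)
  qed
  then have "herz_norm \<nu> a q \<Omega> (\<lambda>x. f x + g x)
     \<le> Lr_norm (count_space {-1..}) q (\<lambda>k. ennreal C * (weighted_norm f k + weighted_norm g k))"
    unfolding herz_eq by (intro Lr_norm_mono[OF q])
  also have "\<dots> = ennreal C * Lr_norm (count_space {-1..}) q (\<lambda>k. weighted_norm f k + weighted_norm g k)"
    by (rule Lr_norm_cmult[OF q]) simp
  also have "\<dots> \<le> ennreal C * (ennreal (Lr_const q) * (herz_norm \<nu> a q \<Omega> f + herz_norm \<nu> a q \<Omega> g))"
    unfolding herz_eq by (intro mult_left_mono Lr_norm_add[OF q]) simp_all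
  also have "\<dots> = ennreal (C * Lr_const q) * (herz_norm \<nu> a q \<Omega> f + herz_norm \<nu> a q \<Omega> g)"
    using C Lr_const_ge_1[of q] by (simp add: ennreal_mult mult.assoc)
  finally show "herz_norm \<nu> a q \<Omega> (\<lambda>x. f x + g x)
     \<le> ennreal (C * Lr_const q) * (herz_norm \<nu> a q \<Omega> f + herz_norm \<nu> a q \<Omega> g)" .
next
  fix f :: "'a \<Rightarrow> real" assume f: "f \<in> borel_measurable (lebesgue_on \<Omega>)" and 0: "herz_norm \<nu> a q \<Omega> f = 0"
  have "AE x in lebesgue. x \<in> shell \<Omega> k \<longrightarrow> f x = 0" if "k \<in> {-1..}" for k
  proof -
    have "weighted_norm f k \<le> 0"
      using le_Lr_norm_count_space[OF q that, of "weighted_norm f"] 0 by (simp add: herz_eq)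
    then have "\<nu> (lebesgue_on (shell \<Omega> k)) (cut \<Omega> k f) = 0" by (simp add: ennreal_eq_0_iff)
    from function_quasi_norm.definite[OF loc measurable_cut[OF \<Omega> f] this]
    show ?thesis
      using sets_shell[OF \<Omega>, of k] by (auto simp: AE_restrict_space_iff cut_def elim: eventually_mono)
  qed
  then have "AE x in lebesgue. \<forall>k\<in>{-1..}. x \<in> shell \<Omega> k \<longrightarrow> f x = 0"
    by (subst AE_ball_countable) auto
  then have "AE x in lebesgue. x \<in> \<Omega> \<longrightarrow> f x = 0"
  proof eventually_elim
    case (elim x)
    then show ?case using mem_shell_iff[OF shell_index_ge, of x \<Omega>] shell_index_ge[of x] by auto
  qed
  then show "AE x in lebesgue_on \<Omega>. f x = 0"
    using \<Omega> by (simp add: AE_restrict_space_iff)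
next
  fix f :: "'a \<Rightarrow> real" and u :: "nat \<Rightarrow> 'a \<Rightarrow> real"
  assume fu: "f \<in> borel_measurable (lebesgue_on \<Omega>)" "\<And>n. u n \<in> borel_measurable (lebesgue_on \<Omega>)"
    and lim: "AE x in lebesgue_on \<Omega>. incseq (\<lambda>n. u n x) \<and> (\<lambda>n. u n x) \<longlonglongrightarrow> \<bar>f x\<bar>"
    and pos: "\<And>n. AE x in lebesgue_on \<Omega>. 0 \<le> u n x"
  note meas = measurable_cut[OF \<Omega> fu(1)] measurable_cut[OF \<Omega> fu(2)]
  have lim_k: "AE x in lebesgue_on (shell \<Omega> k). incseq (\<lambda>n. cut \<Omega> k (u n) x) \<and> (\<lambda>n. cut \<Omega> k (u n) x) \<longlonglongrightarrow> \<bar>cut \<Omega> k f x\<bar>" for k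
    using AE_shell[OF \<Omega> lim] by eventually_elim (auto simp: cut_def indicator_def incseq_def)
  have pos_k: "AE x in lebesgue_on (shell \<Omega> k). 0 \<le> cut \<Omega> k (u n) x" for k n
    using AE_shell[OF \<Omega> pos] by eventually_elim (auto simp: cut_def indicator_def)
  have "weighted_norm f k \<le> (SUP n. weighted_norm (u n) k)" for k
    unfolding SUP_mult_left_ennreal[symmetric]
    using function_quasi_norm.Fatou[OF loc meas lim_k pos_k] by (rule mult_left_mono) simp
  then have "herz_norm \<nu> a q \<Omega> f \<le> Lr_norm (count_space {-1..}) q (\<lambda>k. SUP n. weighted_norm (u n) k)"
    unfolding herz_eq by (intro Lr_norm_mono[OF q])
  also have "\<dots> = (SUP n. herz_norm \<nu> a q \<Omega> (u n))"
    unfolding herz_eq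
  proof (rule Lr_norm_SUP[OF q])
    fix k
    have "incseq (\<lambda>n. \<nu> (lebesgue_on (shell \<Omega> k)) (cut \<Omega> k (u n)))"
      by (rule incseq_of_AE_incseq[where M = "lebesgue_on (shell \<Omega> k)"])
        (use function_quasi_norm.mono[OF loc] meas lim_k pos_k in \<open>auto elim: eventually_mono\<close>)
    then show "incseq (\<lambda>n. weighted_norm (u n) k)" by (auto simp: incseq_def mult_left_mono)
  qed simp
  finally show "herz_norm \<nu> a q \<Omega> f \<le> (SUP n. herz_norm \<nu> a q \<Omega> (u n))" .
qed

lemma herz_space_eq:
  "herz_space \<nu> a q \<Omega> = {f \<in> borel_measurable (lebesgue_on \<Omega>). herz_norm \<nu> a q \<Omega> f < top}"
proof -
  have "cut \<Omega> k f \<in> finite_space \<nu> (shell \<Omega> k)"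
    if "f \<in> borel_measurable (lebesgue_on \<Omega>)" "herz_norm \<nu> a q \<Omega> f < top" "-1 \<le> k" for f k
  proof -
    have "weighted_norm f k \<le> herz_norm \<nu> a q \<Omega> f"
      unfolding herz_eq using that(3)
      by (intro le_Lr_norm_count_space[OF q, of k "{-1..}" "weighted_norm f"]) simp
    then have "weighted_norm f k < top" using that(2) by (rule le_less_trans)
    then have "\<nu> (lebesgue_on (shell \<Omega> k)) (cut \<Omega> k f) < top"
      by (auto simp: ennreal_mult_less_top)
    then show ?thesis
      using measurable_cut[OF \<Omega> that(1)] by (simp add: finite_space_def)
  qed
  then show ?thesis unfolding herz_space_def infinity_ennreal_def by blast
qed

lemma Lr_norm_geometric_finite:
  "Lr_norm (count_space {-1..}) q (\<lambda>k. ennreal (2 powr - real_of_int (k + 1))) < top"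
  using q
proof (cases rule: exponent_cases)
  case top
  have "(SUP k\<in>{-1::int..}. ennreal (2 powr - real_of_int (k + 1))) \<le> ennreal (2 powr 0)"
    by (intro SUP_least ennreal_leI powr_mono) auto
  then have "(SUP k\<in>{-1::int..}. ennreal (2 powr - real_of_int (k + 1))) < top"
    by (rule le_less_trans) simp
  then show ?thesis using top by (simp add: Lr_norm_def)
next
  case (finite s)
  have "(2::real) powr - s < 2 powr 0" using finite by (intro powr_less_mono) auto
  then have "summable (\<lambda>n. (2 powr - s) ^ n)" by (intro summable_geometric) simp
  then have "(\<Sum>n. ennreal ((2 powr - s) ^ n)) \<noteq> top" by (rule ennreal_suminf_neq_top) simp
  moreover have "enn_powr (ennreal (2 powr - real_of_int (int n - 1 + 1))) s = ennreal ((2 powr - s) ^ n)" for n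
  proof -
    have "(2 powr - s) ^ n = (2 powr - s) powr real n" by (rule powr_realpow[symmetric]) simp
    also have "\<dots> = (2 powr - real n) powr s" unfolding powr_powr by (rule arg_cong[where f = "(powr) 2"]) simp
    finally show ?thesis by (subst enn_powr_ennreal) simp_all
  qed
  ultimately have "(\<integral>\<^sup>+k. enn_powr (ennreal (2 powr - real_of_int (k + 1))) s \<partial>count_space {-1..}) < top"
    unfolding nn_integral_shells_eq_suminf by (simp only: less_top simp_thms)
  then show ?thesis
    using finite(1) unfolding Lr_norm_def finite(2) by (simp only: if_False enn_powr_less_top_iff)
qed

text \<open>
  Positive functions on the shells, scaled so that the \<open>k\<close>-th weighted norm is at most
  \<open>2\<^bsup>- (k + 1)\<^esup>\<close>, glue to one positive function with finite norm.
\<close>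

lemma positive_element:
  assumes "\<And>k. -1 \<le> k \<Longrightarrow> \<exists>g \<in> borel_measurable (lebesgue_on (shell \<Omega> k)).
      \<nu> (lebesgue_on (shell \<Omega> k)) g < top \<and> (\<forall>x\<in>shell \<Omega> k. 0 < g x)"
  shows "\<exists>g \<in> borel_measurable (lebesgue_on \<Omega>). herz_norm \<nu> a q \<Omega> g < top \<and> (\<forall>x\<in>\<Omega>. 0 < g x)"
proof -
  obtain g where g: "\<And>k. -1 \<le> k \<Longrightarrow> g k \<in> borel_measurable (lebesgue_on (shell \<Omega> k))"
      "\<And>k. -1 \<le> k \<Longrightarrow> \<nu> (lebesgue_on (shell \<Omega> k)) (g k) < top"
      "\<And>k x. -1 \<le> k \<Longrightarrow> x \<in> shell \<Omega> k \<Longrightarrow> 0 < g k x"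
    using assms by metis
  define b where "b k = enn2real (\<nu> (lebesgue_on (shell \<Omega> k)) (g k))" for k
  define c where "c k = 2 powr - (real_of_int k * a) * 2 powr - real_of_int (k + 1) / (1 + b k)" for k
  have b_nonneg: "0 \<le> b k" for k by (simp add: b_def)
  then have c_pos: "0 < c k" for k by (auto simp: c_def intro!: divide_pos_pos add_pos_nonneg)
  define h where "h x = c (shell_index x) * (g (shell_index x) x * indicator (shell \<Omega> (shell_index x)) x)" for x
  have [measurable]: "h \<in> borel_measurable (lebesgue_on \<Omega>)"
    unfolding h_def
  proof (rule measurable_compose_countable'[OF _ measurable_shell_index[OF \<Omega>]])
    fix k :: int assume "k \<in> {-1..}"
    then have "(\<lambda>x. g k x * indicator (shell \<Omega> k) x) \<in> borel_measurable lebesgue"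
      using g(1)[of k] sets_shell[OF \<Omega>, of k] by (simp add: borel_measurable_restrict_space_iff mult.commute)
    then show "(\<lambda>x. c k * (g k x * indicator (shell \<Omega> k) x)) \<in> borel_measurable (lebesgue_on \<Omega>)"
      by (rule measurable_restrict_space1[OF borel_measurable_times[OF borel_measurable_const]])
  qed simp
  have pos: "0 < h x" if "x \<in> \<Omega>" for x
  proof -
    have "x \<in> shell \<Omega> (shell_index x)" using that by (simp add: mem_shell_iff shell_index_ge)
    with g(3)[OF shell_index_ge this] c_pos show ?thesis by (simp add: h_def)
  qed
  have "weighted_norm h k \<le> ennreal (2 powr - real_of_int (k + 1))" if k: "-1 \<le> k" for k
  proof -
    have "cut \<Omega> k h x = c k * g k x" if "x \<in> shell \<Omega> k" for x
      using that mem_shell_iff[OF k, of x \<Omega>] by (simp add: cut_def h_def)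
    then have "\<nu> (lebesgue_on (shell \<Omega> k)) (cut \<Omega> k h) \<le> \<nu> (lebesgue_on (shell \<Omega> k)) (\<lambda>x. c k * g k x)"
      using g(1)[OF k] by (intro function_quasi_norm.mono[OF loc] measurable_cut \<Omega> AE_I2) auto
    also have "\<dots> = ennreal (c k) * ennreal (b k)"
      using function_quasi_norm.cmult[OF loc g(1)[OF k], of "c k"] g(2)[OF k] c_pos[of k] by (simp add: b_def)
    finally have "weighted_norm h k \<le> ennreal (2 powr (real_of_int k * a)) * (ennreal (c k) * ennreal (b k))"
      by (intro mult_left_mono) simp_all
    also have "\<dots> = ennreal (2 powr (real_of_int k * a) * (c k * b k))"
      using c_pos[of k] b_nonneg[of k] by (simp add: ennreal_mult)
    also have "2 powr (real_of_int k * a) * (c k * b k) = 2 powr - real_of_int (k + 1) * (b k / (1 + b k))"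
    proof -
      have "2 powr (real_of_int k * a) * 2 powr - (real_of_int k * a) = (1::real)"
        by (simp flip: powr_add)
      moreover have "X * (Y * E / B * b) = (X * Y) * (E * (b / B))" for X Y E B b :: real by simp
      ultimately show ?thesis unfolding c_def by (simp only: mult_1_left)
    qed
    also have "\<dots> \<le> 2 powr - real_of_int (k + 1) * 1"
      using b_nonneg[of k] by (intro mult_left_mono) auto
    finally show ?thesis by (simp add: ennreal_leI)
  qed
  then have "herz_norm \<nu> a q \<Omega> h \<le> Lr_norm (count_space {-1..}) q (\<lambda>k. ennreal (2 powr - real_of_int (k + 1)))"
    unfolding herz_eq by (intro Lr_norm_mono[OF q]) simp
  also have "\<dots> < top" by (rule Lr_norm_geometric_finite)
  finally show ?thesis using pos by (intro bexI[of _ h]) auto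
qed

lemma herz_ideal_space:
  assumes "\<And>k. -1 \<le> k \<Longrightarrow> \<exists>g \<in> borel_measurable (lebesgue_on (shell \<Omega> k)).
      \<nu> (lebesgue_on (shell \<Omega> k)) g < top \<and> (\<forall>x\<in>shell \<Omega> k. 0 < g x)"
  shows "quasi_Banach_ideal_space \<Omega> (herz_space \<nu> a q \<Omega>) (\<lambda>f. enn2real (herz_norm \<nu> a q \<Omega> f))"
    and "Fatou_property \<Omega> (herz_space \<nu> a q \<Omega>) (\<lambda>f. enn2real (herz_norm \<nu> a q \<Omega> f))"
    and "C = 1 \<Longrightarrow> 1 \<le> q \<Longrightarrow>
      Banach_ideal_space \<Omega> (herz_space \<nu> a q \<Omega>) (\<lambda>f. enn2real (herz_norm \<nu> a q \<Omega> f))"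
proof -
  obtain g where g: "g \<in> borel_measurable (lebesgue_on \<Omega>)" "herz_norm \<nu> a q \<Omega> g < top" "\<And>x. x \<in> \<Omega> \<Longrightarrow> 0 < g x"
    using positive_element[OF assms] by blast
  note * = function_quasi_norm_imp_ideal_space[OF herz_function_quasi_norm g, folded herz_space_eq]
  show "quasi_Banach_ideal_space \<Omega> (herz_space \<nu> a q \<Omega>) (\<lambda>f. enn2real (herz_norm \<nu> a q \<Omega> f))"
    "Fatou_property \<Omega> (herz_space \<nu> a q \<Omega>) (\<lambda>f. enn2real (herz_norm \<nu> a q \<Omega> f))"
    using *(1,2) by blast+
  show "Banach_ideal_space \<Omega> (herz_space \<nu> a q \<Omega>) (\<lambda>f. enn2real (herz_norm \<nu> a q \<Omega> f))"
    if "C = 1" "1 \<le> q"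
  proof -
    have "C * Lr_const q = 1" using that by (simp add: Lr_const_def)
    from *(3)[OF _ this] show ?thesis by blast
  qed
qed

end

section \<open>Lorentz-Herz spaces\<close>

lemma one_le_imp_pos: "1 \<le> x \<Longrightarrow> 0 < x" for x :: ennreal
  by (rule less_le_trans[of _ 1]) simp_all

lemma HL_quasi_Banach:
  assumes \<Omega>: "\<Omega> \<in> sets lebesgue" and q: "0 < q"
    and pr: "(0 < p \<and> p < \<infinity> \<and> 0 < r \<and> r < \<infinity>) \<or> (r = \<infinity> \<and> 0 < p)"
  shows "quasi_Banach_ideal_space \<Omega> (HL_space p r a q \<Omega>) (\<lambda>f. enn2real (HL_norm p r a q \<Omega> f)) \<and>
    Fatou_property \<Omega> (HL_space p r a q \<Omega>) (\<lambda>f. enn2real (HL_norm p r a q \<Omega> f))"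
proof -
  have r: "0 < r" using pr by auto
  interpret herz_family \<Omega> "2 powr enn2real (1 / p) * Lr_const r" "lorentz_norm p r" a q
    by (intro herz_family.intro \<Omega> q lorentz_function_quasi_norm r)
  have "\<exists>g \<in> borel_measurable (lebesgue_on (shell \<Omega> k)).
      lorentz_norm p r (lebesgue_on (shell \<Omega> k)) g < top \<and> (\<forall>x\<in>shell \<Omega> k. 0 < g x)" for k
    using lorentz_norm_one_finite[OF finite_measure_shell[OF \<Omega>] r] pr
    by (intro bexI[of _ "\<lambda>x. 1"]) auto
  from herz_ideal_space(1,2)[OF this] show ?thesis
    unfolding HL_space_def HL_norm_def ..
qed

lemma HL_Banach:
  assumes \<Omega>: "\<Omega> \<in> sets lebesgue" and q1: "1 \<le> q"
    and pr: "(1 \<le> r \<and> r \<le> p \<and> p < \<infinity>) \<or> (p = \<infinity> \<and> r = \<infinity>)"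
  shows "Banach_ideal_space \<Omega> (HL_space p r a q \<Omega>) (\<lambda>f. enn2real (HL_norm p r a q \<Omega> f)) \<and>
    Fatou_property \<Omega> (HL_space p r a q \<Omega>) (\<lambda>f. enn2real (HL_norm p r a q \<Omega> f))"
proof -
  have r: "0 < r" using pr one_le_imp_pos by auto
  have p: "0 < p" using pr less_le_trans[OF r] by auto
  note fin = finite_measure_shell[OF \<Omega>]
  interpret herz_family \<Omega> 1 "lorentz_norm p r" a q
    by (intro herz_family.intro \<Omega> one_le_imp_pos q1 lorentz_function_norm[OF finite_measure.axioms(1)[OF fin] pr])
  have "\<exists>g \<in> borel_measurable (lebesgue_on (shell \<Omega> k)).
      lorentz_norm p r (lebesgue_on (shell \<Omega> k)) g < top \<and> (\<forall>x\<in>shell \<Omega> k. 0 < g x)" for k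
    using lorentz_norm_one_finite[OF fin r p] pr by (intro bexI[of _ "\<lambda>x. 1"]) auto
  from herz_ideal_space(3)[OF this refl q1] herz_ideal_space(2)[OF this] show ?thesis
    unfolding HL_space_def HL_norm_def ..
qed

text \<open>
  The positive functions on the shells come from the assumption on the local spaces. The constant
  \<open>1\<close> cannot replace them: on a shell of positive measure \<open>f\<^sup>*\<^sup>*(t)\<close> decays no faster than \<open>1 / t\<close>
  unless \<open>f\<close> vanishes, so for \<open>p < 1\<close>, and for \<open>p = 1\<close> with \<open>r < \<infinity>\<close>, the local space is trivial.
\<close>

lemma HL_avg_quasi_Banach:
  assumes \<Omega>: "\<Omega> \<in> sets lebesgue" and q: "0 < q" and r: "0 < r"
    and local: "\<And>k. -1 \<le> k \<Longrightarrow> quasi_normed_ideal_space (shell \<Omega> k) (lorentz_avg_space p r (shell \<Omega> k))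
                   (\<lambda>f. enn2real (lorentz_avg_norm p r (lebesgue_on (shell \<Omega> k)) f))"
  shows "quasi_Banach_ideal_space \<Omega> (HL_avg_space p r a q \<Omega>) (\<lambda>f. enn2real (HL_avg_norm p r a q \<Omega> f)) \<and>
    Fatou_property \<Omega> (HL_avg_space p r a q \<Omega>) (\<lambda>f. enn2real (HL_avg_norm p r a q \<Omega> f))"
proof -
  note sig = finite_measure.axioms(1)[OF finite_measure_shell[OF \<Omega>]]
  interpret herz_family \<Omega> "Lr_const r" "lorentz_avg_norm p r" a q
    by (intro herz_family.intro \<Omega> q lorentz_avg_function_quasi_norm[OF sig r])
  have "\<exists>g \<in> borel_measurable (lebesgue_on (shell \<Omega> k)).
      lorentz_avg_norm p r (lebesgue_on (shell \<Omega> k)) g < top \<and> (\<forall>x\<in>shell \<Omega> k. 0 < g x)" if "-1 \<le> k" for k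
    using local[OF that]
    by (auto simp: quasi_normed_ideal_space_def lorentz_avg_space_def finite_space_def)
  from herz_ideal_space(1,2)[OF this] show ?thesis
    unfolding HL_avg_space_def HL_avg_norm_def ..
qed

lemma HL_avg_Banach:
  assumes \<Omega>: "\<Omega> \<in> sets lebesgue" and q1: "1 \<le> q"
    and pr: "(1 \<le> r \<and> 1 < p \<and> p < \<infinity>) \<or> (p = \<infinity> \<and> r = \<infinity>)"
  shows "Banach_ideal_space \<Omega> (HL_avg_space p r a q \<Omega>) (\<lambda>f. enn2real (HL_avg_norm p r a q \<Omega> f)) \<and>
    Fatou_property \<Omega> (HL_avg_space p r a q \<Omega>) (\<lambda>f. enn2real (HL_avg_norm p r a q \<Omega> f))"
proof -
  note fin = finite_measure_shell[OF \<Omega>]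
  have r: "1 \<le> r" using pr by auto
  have "Lr_const r = 1" using r by (simp add: Lr_const_def)
  then interpret herz_family \<Omega> 1 "lorentz_avg_norm p r" a q
    using lorentz_avg_function_quasi_norm[OF finite_measure.axioms(1)[OF fin] one_le_imp_pos[OF r]]
    by (intro herz_family.intro \<Omega> one_le_imp_pos q1) simp
  have "\<exists>g \<in> borel_measurable (lebesgue_on (shell \<Omega> k)).
      lorentz_avg_norm p r (lebesgue_on (shell \<Omega> k)) g < top \<and> (\<forall>x\<in>shell \<Omega> k. 0 < g x)" for k
    using lorentz_avg_norm_one_finite[OF fin one_le_imp_pos[OF r]] pr
    by (intro bexI[of _ "\<lambda>x. 1"]) auto
  from herz_ideal_space(3)[OF this refl q1] herz_ideal_space(2)[OF this] show ?thesis
    unfolding HL_avg_space_def HL_avg_norm_def ..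
qed

theorem corollary3p1p3:
  fixes \<Omega> :: "(real ^ 'n) set" and a :: real
  assumes "\<Omega> \<in> sets lebesgue"
  shows
    "(\<forall>p r q :: ennreal.
        0 < q \<longrightarrow>
        (0 < p \<and> p < \<infinity> \<and> 0 < r \<and> r < \<infinity>) \<or> (r = \<infinity> \<and> 0 < p) \<longrightarrow>
          quasi_Banach_ideal_space \<Omega> (HL_space p r a q \<Omega>) (\<lambda>f. enn2real (HL_norm p r a q \<Omega> f)) \<and>
          Fatou_property \<Omega> (HL_space p r a q \<Omega>) (\<lambda>f. enn2real (HL_norm p r a q \<Omega> f)))
     \<and>
     (\<forall>p r q :: ennreal.
        1 \<le> q \<longrightarrow>
        (1 \<le> r \<and> r \<le> p \<and> p < \<infinity>) \<or> (p = \<infinity> \<and> r = \<infinity>) \<longrightarrow>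
          Banach_ideal_space \<Omega> (HL_space p r a q \<Omega>) (\<lambda>f. enn2real (HL_norm p r a q \<Omega> f)) \<and>
          Fatou_property \<Omega> (HL_space p r a q \<Omega>) (\<lambda>f. enn2real (HL_norm p r a q \<Omega> f)))
     \<and>
     (\<forall>p r q :: ennreal.
        0 < q \<longrightarrow> 0 < r \<longrightarrow> 0 < p \<and> p < \<infinity> \<longrightarrow>
        (\<forall>k\<ge>-1. quasi_normed_ideal_space (shell \<Omega> k) (lorentz_avg_space p r (shell \<Omega> k))
                   (\<lambda>f. enn2real (lorentz_avg_norm p r (lebesgue_on (shell \<Omega> k)) f))) \<longrightarrow>
          quasi_Banach_ideal_space \<Omega> (HL_avg_space p r a q \<Omega>)
            (\<lambda>f. enn2real (HL_avg_norm p r a q \<Omega> f)) \<and>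
          Fatou_property \<Omega> (HL_avg_space p r a q \<Omega>) (\<lambda>f. enn2real (HL_avg_norm p r a q \<Omega> f)))
     \<and>
     (\<forall>p r q :: ennreal.
        1 \<le> q \<longrightarrow>
        (1 \<le> r \<and> 1 < p \<and> p < \<infinity>) \<or> (p = \<infinity> \<and> r = \<infinity>) \<longrightarrow>
          Banach_ideal_space \<Omega> (HL_avg_space p r a q \<Omega>)
            (\<lambda>f. enn2real (HL_avg_norm p r a q \<Omega> f)) \<and>
          Fatou_property \<Omega> (HL_avg_space p r a q \<Omega>) (\<lambda>f. enn2real (HL_avg_norm p r a q \<Omega> f)))"
  by (intro conjI[OF _ conjI[OF _ conjI]] allI impI
      HL_quasi_Banach HL_Banach HL_avg_quasi_Banach HL_avg_Banach assms) (assumption | blast)+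

end
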